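(* If the visibility graph of a reduced simple polygon is $4$-colourable, then it has a unique proper $4$-colouring up to a permutation of the colours.
   Context: For a simple polygon $P$ (a closed region), two points are mutually visible if the segment joining them does not meet the exterior of $P$. The visibility graph of $P$ has the polygon vertices as vertices and edges between mutually visible pairs of polygon vertices. A chord of $P$ is an edge of the visibility graph which is not a side of the polygon (an internal diagonal). $P$ is called reduced if every chord of $P$ is crossed by another chord of $P$. *)

theory Defs
  imports "HOL-Analysis.Analysis" "HOL-Combinatorics.Permutations"
begin

text \<open>The Euclidean plane is \<^typ>\<open>complex\<close>, for which the library states the Jordan curve
  theorem. A polygon is given by the list of its vertices in cyclic order; side \<open>i\<close> joins
  vertex \<open>i\<close> to its cyclic successor.\<close>

definition next_idx :: "complex list \<Rightarrow> nat \<Rightarrow> nat" where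
  "next_idx vs i = Suc i mod length vs"

definition side_seg :: "complex list \<Rightarrow> nat \<Rightarrow> complex set" where
  "side_seg vs i = closed_segment (vs ! i) (vs ! next_idx vs i)"

definition simple_polygon :: "complex list \<Rightarrow> bool" where
  "simple_polygon vs \<longleftrightarrow>
     length vs \<ge> 3 \<and> distinct vs \<and>
     (\<forall>i<length vs. side_seg vs i \<inter> side_seg vs (next_idx vs i) = {vs ! next_idx vs i}) \<and>
     (\<forall>i<length vs. \<forall>j<length vs.
        i \<noteq> j \<and> j \<noteq> next_idx vs i \<and> i \<noteq> next_idx vs j \<longrightarrow> side_seg vs i \<inter> side_seg vs j = {})"

definition polygon_boundary :: "complex list \<Rightarrow> complex set" where
  "polygon_boundary vs = (\<Union>i<length vs. side_seg vs i)"

definition polygon_region :: "complex list \<Rightarrow> complex set" where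
  "polygon_region vs = polygon_boundary vs \<union> inside (polygon_boundary vs)"

text \<open>The region is closed, so its exterior is its complement. A line of sight may touch the
  boundary and may pass through other vertices.\<close>

definition visible :: "complex list \<Rightarrow> complex \<Rightarrow> complex \<Rightarrow> bool" where
  "visible vs x y \<longleftrightarrow> closed_segment x y \<inter> (- polygon_region vs) = {}"

definition vis_adj :: "complex list \<Rightarrow> complex \<Rightarrow> complex \<Rightarrow> bool" where
  "vis_adj vs u v \<longleftrightarrow> u \<in> set vs \<and> v \<in> set vs \<and> u \<noteq> v \<and> visible vs u v"

definition polygon_sides :: "complex list \<Rightarrow> complex set set" where
  "polygon_sides vs = {{vs ! i, vs ! next_idx vs i} | i. i < length vs}"

definition chord :: "complex list \<Rightarrow> complex \<Rightarrow> complex \<Rightarrow> bool" where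
  "chord vs u v \<longleftrightarrow> vis_adj vs u v \<and> {u, v} \<notin> polygon_sides vs"

text \<open>Requiring a single common point excludes collinear overlapping segments; using open segments
  excludes segments that only share an endpoint or where one merely ends on the other.\<close>

definition crosses :: "complex \<Rightarrow> complex \<Rightarrow> complex \<Rightarrow> complex \<Rightarrow> bool" where
  "crosses u v a b \<longleftrightarrow> (\<exists>x. open_segment u v \<inter> open_segment a b = {x})"

definition reduced_polygon :: "complex list \<Rightarrow> bool" where
  "reduced_polygon vs \<longleftrightarrow> (\<forall>u v. chord vs u v \<longrightarrow> (\<exists>a b. chord vs a b \<and> crosses u v a b))"

text \<open>Graphs are given by a vertex set and an adjacency relation. Not every colour need be used.\<close>

definition proper_colouring ::
    "'a set \<Rightarrow> ('a \<Rightarrow> 'a \<Rightarrow> bool) \<Rightarrow> nat \<Rightarrow> ('a \<Rightarrow> nat) \<Rightarrow> bool" where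
  "proper_colouring V adj k c \<longleftrightarrow>
     (\<forall>v\<in>V. c v < k) \<and> (\<forall>u\<in>V. \<forall>v\<in>V. adj u v \<longrightarrow> c u \<noteq> c v)"

definition colourable :: "'a set \<Rightarrow> ('a \<Rightarrow> 'a \<Rightarrow> bool) \<Rightarrow> nat \<Rightarrow> bool" where
  "colourable V adj k \<longleftrightarrow> (\<exists>c. proper_colouring V adj k c)"

definition uniquely_colourable :: "'a set \<Rightarrow> ('a \<Rightarrow> 'a \<Rightarrow> bool) \<Rightarrow> nat \<Rightarrow> bool" where
  "uniquely_colourable V adj k \<longleftrightarrow>
     (\<exists>c. proper_colouring V adj k c \<and>
       (\<forall>c'. proper_colouring V adj k c' \<longrightarrow>
         (\<exists>p. p permutes {..<k} \<and> (\<forall>v\<in>V. c' v = p (c v)))))"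

end

theory Submission
  imports Defs
begin

text \<open>Call a line of sight between two vertices clean if it is a side or runs through the open
  interior. A clean chord \<open>u v\<close> is crossed by another chord, so sweeping rays about \<open>u\<close> and \<open>v\<close>
  yields a vertex on either side of it such that the four vertices form a clique. Moreover, the
  vertices on one side of \<open>u v\<close> that see both \<open>u\<close> and \<open>v\<close> are linked by a chain in which consecutive
  ones see each other. Hence two 4-colourings that agree up to a permutation on one triangle over
  \<open>u v\<close> agree, with the same permutation, on every triangle over \<open>u v\<close>. Around each vertex the clean
  edges are joined by a fan of triangles from one incident side to the other, so the agreement
  travels around the whole boundary.\<close>

section \<open>Plane geometry\<close>

text \<open>Two triangles that merely share an edge leave the colour of the second apex
  undetermined. Reducedness repairs this for interior chords: it provides apexes on opposite flanks
  that see each other. The crossing chord itself may graze the boundary, so its ends cannot serve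
  directly and are replaced by vertices reached through the open interior. Clean edges are the right
  notion because three of them in general position bound a triangle full of interior points, and
  because no vertex lies strictly inside one of them. Straight angles are permitted by
  \<open>simple_polygon\<close>, and lines of sight may contain further vertices, so collinear
  configurations have to be kept apart throughout. Signs of \<open>orient\<close> and barycentric
  coordinates do this bookkeeping. The number four enters as follows: an agreeing triangle uses
  three colours, so a vertex that sees all three corners is left with exactly one.\<close>

definition orient :: "complex \<Rightarrow> complex \<Rightarrow> complex \<Rightarrow> real" where
  "orient p q z = Im (cnj (q - p) * (z - p))"

text \<open>Positive weights instead of a topological interior: for collinear triples this still
  makes sense, as the relative interior of the hull, so the splitting and monotonicity lemmas need
  no hypothesis on \<open>orient\<close>.\<close>

definition open_triangle :: "complex \<Rightarrow> complex \<Rightarrow> complex \<Rightarrow> complex set" where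
  "open_triangle p q r = {a *\<^sub>R p + b *\<^sub>R q + c *\<^sub>R r | a b c. 0 < a \<and> 0 < b \<and> 0 < c \<and> a + b + c = 1}"

lemma open_triangleI: "0 < a \<Longrightarrow> 0 < b \<Longrightarrow> 0 < c \<Longrightarrow> a + b + c = 1 \<Longrightarrow>
    z = a *\<^sub>R p + b *\<^sub>R q + c *\<^sub>R r \<Longrightarrow> z \<in> open_triangle p q r"
  unfolding open_triangle_def by blast

lemma open_triangleE:
  assumes "z \<in> open_triangle p q r"
  obtains a b c where "0 < a" "0 < b" "0 < c" "a + b + c = 1"
    "z = a *\<^sub>R p + b *\<^sub>R q + c *\<^sub>R r"
  using assms unfolding open_triangle_def by blast

lemma open_triangle_rotate: "open_triangle p q r = open_triangle q r p"
proof -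
  have "open_triangle p q r \<subseteq> open_triangle q r p" for p q r
  proof
    fix z assume "z \<in> open_triangle p q r"
    then obtain a b c where "0 < a" "0 < b" "0 < c" "a + b + c = 1"
      "z = a *\<^sub>R p + b *\<^sub>R q + c *\<^sub>R r" by (rule open_triangleE)
    thus "z \<in> open_triangle q r p" by (intro open_triangleI[of b c a]) auto
  qed
  thus ?thesis by blast
qed

lemma open_triangle_swap: "open_triangle p q r = open_triangle q p r"
proof -
  have "open_triangle p q r \<subseteq> open_triangle q p r" for p q r
  proof
    fix z assume "z \<in> open_triangle p q r"
    then obtain a b c where "0 < a" "0 < b" "0 < c" "a + b + c = 1"
      "z = a *\<^sub>R p + b *\<^sub>R q + c *\<^sub>R r" by (rule open_triangleE)
    thus "z \<in> open_triangle q p r" by (intro open_triangleI[of b a c]) auto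
  qed
  thus ?thesis by blast
qed

lemma open_triangle_swap': "open_triangle p q r = open_triangle p r q"
  using open_triangle_rotate open_triangle_swap by metis

text \<open>\<open>orient p q z\<close> is twice the signed area of the triangle, positive when
  \<open>z\<close> lies to the left of the ray from \<open>p\<close> through \<open>q\<close>;
  signed area is invariant under cyclic shifts.\<close>

lemma orient_rotate: "orient p q r = orient q r p"
  by (simp add: orient_def algebra_simps)

lemma orient_swap: "orient p q r = - orient q p r"
  by (simp add: orient_def algebra_simps)

lemma orient_same [simp]: "orient p q p = 0" "orient p q q = 0" "orient p p q = 0"
  by (simp_all add: orient_def algebra_simps)

lemma orient_affine:
  assumes "a + b = 1"
  shows "orient p q (a *\<^sub>R y + b *\<^sub>R z) = a * orient p q y + b * orient p q z"
proof -
  have a: "a = 1 - b" using assms by simp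
  show ?thesis unfolding a by (simp add: orient_def algebra_simps)
qed

lemma orient_bary:
  assumes "a + b + c = 1"
  shows "orient p q (a *\<^sub>R p + b *\<^sub>R q + c *\<^sub>R r) = c * orient p q r"
proof -
  have a: "a = 1 - b - c" using assms by simp
  show ?thesis unfolding a by (simp add: orient_def algebra_simps)
qed

lemma orient_bary3:
  assumes "a + b + c = 1"
  shows "orient p q (a *\<^sub>R x + b *\<^sub>R y + c *\<^sub>R z) = a * orient p q x + b * orient p q y + c * orient p q z"
proof -
  have a: "a = 1 - b - c" using assms by simp
  show ?thesis unfolding a by (simp add: orient_def algebra_simps)
qed

text \<open>Cramer's rule: each coordinate is the signed area of the triangle that \<open>z\<close>
  spans with the opposite edge, divided by the whole area \<open>D\<close>.\<close>

lemma bary_exists: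
  assumes "orient p q r \<noteq> 0"
  obtains a b c where "a + b + c = 1" "z = a *\<^sub>R p + b *\<^sub>R q + c *\<^sub>R r"
proof -
  define D where "D = orient p q r"
  have D: "D \<noteq> 0" using assms D_def by simp
  define a b c where "a = orient q r z / D" and "b = orient r p z / D" and "c = orient p q z / D"
  have "orient q r z + orient r p z + orient p q z = D"
    by (simp add: D_def orient_def algebra_simps)
  hence 1: "a + b + c = 1"
    using D by (simp add: a_def b_def c_def field_simps)
  have "D *\<^sub>R z = orient q r z *\<^sub>R p + orient r p z *\<^sub>R q + orient p q z *\<^sub>R r"
    by (rule complex_eqI) (simp_all add: D_def orient_def algebra_simps)
  also have "\<dots> = D *\<^sub>R (a *\<^sub>R p + b *\<^sub>R q + c *\<^sub>R r)"
    using D by (simp add: a_def b_def c_def scaleR_add_right)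
  finally have "z = a *\<^sub>R p + b *\<^sub>R q + c *\<^sub>R r" using D by simp
  with 1 show ?thesis using that by blast
qed

lemma orient_nonzero_not_collinear:
  assumes "orient p q r \<noteq> 0" shows "\<not> collinear {p, q, r}"
proof
  assume c: "collinear {p, q, r}"
  have "p \<noteq> q" using assms by auto
  have "collinear {q, p, r}" using c by (simp add: insert_commute)
  then obtain k where "p = r \<or> q = k *\<^sub>R p + (1 - k) *\<^sub>R r"
    using c by (metis collinear_3_expand)
  thus False
  proof
    assume "p = r" thus False using assms by simp
  next
    assume "q = k *\<^sub>R p + (1 - k) *\<^sub>R r"
    moreover have "orient p (k *\<^sub>R p + (1 - k) *\<^sub>R r) r = 0"
      by (simp add: orient_def algebra_simps)
    ultimately have "orient p q r = 0" by simp
    thus False using assms by simp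
  qed
qed

lemma open_triangle_eq_interior:
  assumes "orient p q r \<noteq> 0" shows "open_triangle p q r = interior (convex hull {p, q, r})"
  using interior_convex_hull_3_minimal[OF orient_nonzero_not_collinear[OF assms]]
  by (auto simp: open_triangle_def)

lemma open_open_triangle: "orient p q r \<noteq> 0 \<Longrightarrow> open (open_triangle p q r)"
  by (simp add: open_triangle_eq_interior)

lemma convex_open_triangle: "orient p q r \<noteq> 0 \<Longrightarrow> convex (open_triangle p q r)"
  by (simp add: open_triangle_eq_interior convex_interior)

lemma open_triangle_nonempty: "open_triangle p q r \<noteq> {}"
  using open_triangleI[of "1/3" "1/3" "1/3"] by force

lemma closure_open_triangle: "orient p q r \<noteq> 0 \<Longrightarrow> closure (open_triangle p q r) = convex hull {p, q, r}"
  using open_triangle_nonempty[of p q r]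
  by (simp add: open_triangle_eq_interior convex_closure_interior compact_convex_hull compact_imp_closed)

lemma in_hull3: 
  "z \<in> convex hull {p, q, r} \<longleftrightarrow>
    (\<exists>a b c. 0 \<le> a \<and> 0 \<le> b \<and> 0 \<le> c \<and> a + b + c = 1 \<and> z = a *\<^sub>R p + b *\<^sub>R q + c *\<^sub>R r)"
  by (auto simp: convex_hull_3)

lemma in_hull3I:
  "0 \<le> a \<Longrightarrow> 0 \<le> b \<Longrightarrow> 0 \<le> c \<Longrightarrow> a + b + c = 1 \<Longrightarrow> z = a *\<^sub>R p + b *\<^sub>R q + c *\<^sub>R r
    \<Longrightarrow> z \<in> convex hull {p, q, r}"
  unfolding in_hull3 by blast

lemma open_triangle_subset_hull: "open_triangle p q r \<subseteq> convex hull {p, q, r}"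
  unfolding in_hull3 open_triangle_def subset_iff by (blast intro: less_imp_le)

lemma frontier_hull3:
  "orient p q r \<noteq> 0 \<Longrightarrow> frontier (convex hull {p, q, r}) =
    closed_segment p q \<union> closed_segment q r \<union> closed_segment r p"
  by (rule frontier_of_triangle) simp

lemma open_segmentE:
  assumes "z \<in> open_segment a b"
  obtains t where "0 < t" "t < 1" "z = (1 - t) *\<^sub>R a + t *\<^sub>R b" "a \<noteq> b"
  using assms by (auto simp: in_segment)

lemma open_segmentI:
  "0 < t \<Longrightarrow> t < 1 \<Longrightarrow> z = (1 - t) *\<^sub>R a + t *\<^sub>R b \<Longrightarrow> a \<noteq> b \<Longrightarrow> z \<in> open_segment a b"
  by (auto simp: in_segment)

lemma closed_segmentE:
  assumes "z \<in> closed_segment a b"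
  obtains t where "0 \<le> t" "t \<le> 1" "z = (1 - t) *\<^sub>R a + t *\<^sub>R b"
  using assms by (auto simp: in_segment)

lemma orient_open_segment:
  assumes "z \<in> open_segment a b"
  obtains t where "0 < t" "t < 1" "z = (1 - t) *\<^sub>R a + t *\<^sub>R b"
    "\<And>p q. orient p q z = (1 - t) * orient p q a + t * orient p q b"
proof -
  obtain t where t: "0 < t" "t < 1" "z = (1 - t) *\<^sub>R a + t *\<^sub>R b"
    using assms by (auto elim: open_segmentE)
  show ?thesis by (rule that[OF t]) (simp add: t orient_affine)
qed

text \<open>A segment entering the triangle would have to leave it twice through the one edge \<open>p y\<close>.\<close>

lemma segment_avoids_open_triangle:
  assumes nc: "orient p x y \<noteq> 0"
    and g: "g \<notin> open_triangle p x y" and h: "h \<notin> open_triangle p x y"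
    and meets: "closed_segment g h \<inter> (closed_segment p x \<union> closed_segment x y) \<subseteq> {p, y}"
  shows "closed_segment g h \<inter> open_triangle p x y = {}"
proof (rule ccontr)
  let ?K = "convex hull {p, x, y}"
  assume "closed_segment g h \<inter> open_triangle p x y \<noteq> {}"
  then obtain z where z: "z \<in> closed_segment g h" "z \<in> open_triangle p x y" by blast
  have ex: "\<exists>e \<in> closed_segment z k. e \<in> closed_segment p y"
    if k: "k \<notin> open_triangle p x y" "closed_segment z k \<subseteq> closed_segment g h" for k
  proof -
    have "closed_segment z k \<inter> frontier (open_triangle p x y) \<noteq> {}"
      using z k by (intro connected_Int_frontier) auto
    moreover have "frontier (open_triangle p x y) = frontier ?K"
      using open_triangle_eq_interior[OF nc] closure_open_triangle[OF nc]
      by (simp add: frontier_def compact_convex_hull compact_imp_closed)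
    ultimately obtain e where e: "e \<in> closed_segment z k"
        "e \<in> closed_segment p x \<union> closed_segment x y \<union> closed_segment y p"
      using frontier_hull3[OF nc] by blast
    hence "e \<in> closed_segment p y"
      using meets k by (auto simp: closed_segment_commute)
    thus ?thesis using e by blast
  qed
  obtain e1 where e1: "e1 \<in> closed_segment z g" "e1 \<in> closed_segment p y"
    using ex[OF g] z by (metis ends_in_segment(1) subset_closed_segment)
  obtain e2 where e2: "e2 \<in> closed_segment z h" "e2 \<in> closed_segment p y"
    using ex[OF h] z by (metis ends_in_segment(2) subset_closed_segment)
  have "z \<in> closed_segment e1 e2"
  proof -
    have b: "between (g, h) z" "between (z, g) e1" "between (z, h) e2"
      using z e1 e2 by (auto simp: between_mem_segment)
    thus ?thesis
      by (metis between_commute between_mem_segment between_swap between_trans between_trans_2)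
  qed
  hence "z \<in> closed_segment p y"
    using e1 e2 by (meson closed_segment_subset convex_closed_segment subsetD)
  hence "z \<in> frontier ?K" using frontier_hull3[OF nc] by (auto simp: closed_segment_commute)
  thus False using z open_triangle_eq_interior[OF nc] by (auto simp: frontier_def)
qed

text \<open>The segment from \<open>y\<close> to \<open>x\<close> cuts the triangle in two.
  Comparing \<open>a : b\<close> with the ratio in which \<open>x\<close> divides \<open>u v\<close>
  tells the piece containing \<open>z\<close>; its new coordinates arise by trading the whole weight
  of the far corner for weight on \<open>x\<close>.\<close>

lemma open_triangle_split:
  assumes "x \<in> open_segment u v" "x \<noteq> y"
  shows "open_triangle u v y \<subseteq> open_triangle u x y \<union> open_segment x y \<union> open_triangle v x y"
proof
  fix z assume "z \<in> open_triangle u v y"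
  then obtain a b c where abc: "0 < a" "0 < b" "0 < c" "a + b + c = 1"
    "z = a *\<^sub>R u + b *\<^sub>R v + c *\<^sub>R y" by (rule open_triangleE)
  obtain k where k: "0 < k" "k < 1" "x = (1 - k) *\<^sub>R u + k *\<^sub>R v"
    using assms by (auto elim: open_segmentE)
  consider "a * k > b * (1 - k)" | "a * k = b * (1 - k)" | "a * k < b * (1 - k)" by linarith
  thus "z \<in> open_triangle u x y \<union> open_segment x y \<union> open_triangle v x y"
  proof cases
    case 1
    define b' a' where "b' = b / k" and "a' = a - b' * (1 - k)"
    have b: "b = b' * k" and a: "a = a' + b' * (1 - k)"
      using k by (simp_all add: a'_def b'_def)
    have "b' > 0" using abc k by (simp add: b'_def)
    moreover have "a' > 0" using 1 k by (simp add: a'_def b'_def field_simps)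
    moreover have "a' + b' + c = 1" using abc(4) unfolding a b by (simp add: algebra_simps)
    moreover have "z = a' *\<^sub>R u + b' *\<^sub>R x + c *\<^sub>R y"
      unfolding abc(5) a b k(3) by (simp add: algebra_simps)
    ultimately have "z \<in> open_triangle u x y" using abc(3) by (blast intro: open_triangleI)
    thus ?thesis by simp
  next
    case 2
    have b: "(a + b) * k = b" and a: "(a + b) * (1 - k) = a"
      using 2 by (simp_all add: algebra_simps)
    have "z = ((a + b) * (1 - k)) *\<^sub>R u + ((a + b) * k) *\<^sub>R v + c *\<^sub>R y"
      unfolding abc(5) a b ..
    also have "\<dots> = (a + b) *\<^sub>R x + c *\<^sub>R y"
      unfolding k(3) by (simp only: scaleR_add_right scaleR_scaleR)
    also have "a + b = 1 - c" using abc by simp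
    finally have "z = (1 - c) *\<^sub>R x + c *\<^sub>R y" .
    hence "z \<in> open_segment x y" using abc assms(2) by (intro open_segmentI[of c]) auto
    thus ?thesis by simp
  next
    case 3
    define a' b' where "a' = a / (1 - k)" and "b' = b - a' * k"
    have a: "a = a' * (1 - k)" and b: "b = b' + a' * k"
      using k by (simp_all add: a'_def b'_def)
    have "a' > 0" using abc k by (simp add: a'_def)
    moreover have "b' > 0" using 3 k by (simp add: a'_def b'_def field_simps)
    moreover have "b' + a' + c = 1" using abc(4) unfolding a b by (simp add: algebra_simps)
    moreover have "z = b' *\<^sub>R v + a' *\<^sub>R x + c *\<^sub>R y"
      unfolding abc(5) a b k(3) by (simp add: algebra_simps)
    ultimately have "z \<in> open_triangle v x y" using abc(3) by (blast intro: open_triangleI)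
    thus ?thesis by simp
  qed
qed

lemma open_triangle_mono:
  assumes "y \<in> open_segment x r"
  shows "open_triangle p x y \<subseteq> open_triangle p x r"
proof
  fix z assume "z \<in> open_triangle p x y"
  then obtain a b c where abc: "0 < a" "0 < b" "0 < c" "a + b + c = 1"
    "z = a *\<^sub>R p + b *\<^sub>R x + c *\<^sub>R y" by (rule open_triangleE)
  obtain k where k: "0 < k" "k < 1" "y = (1 - k) *\<^sub>R x + k *\<^sub>R r"
    using assms by (auto elim: open_segmentE)
  show "z \<in> open_triangle p x r"
  proof (rule open_triangleI[of a "b + c * (1 - k)" "c * k"])
    show "0 < b + c * (1 - k)" using abc k by (simp add: add_pos_pos)
    show "a + (b + c * (1 - k)) + c * k = 1" using abc by (simp add: algebra_simps)
  qed (use abc k in \<open>auto simp: algebra_simps\<close>)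
qed

lemma open_segment_subset_open_triangle:
  assumes "w \<in> open_segment v y"
  shows "open_segment u w \<subseteq> open_triangle u v y"
proof
  fix z assume "z \<in> open_segment u w"
  then obtain t where t: "0 < t" "t < 1" "z = (1 - t) *\<^sub>R u + t *\<^sub>R w" by (rule open_segmentE)
  obtain k where k: "0 < k" "k < 1" "w = (1 - k) *\<^sub>R v + k *\<^sub>R y"
    using assms by (auto elim: open_segmentE)
  show "z \<in> open_triangle u v y"
  proof (rule open_triangleI[of "1 - t" "t * (1 - k)" "t * k"])
    show "z = (1 - t) *\<^sub>R u + (t * (1 - k)) *\<^sub>R v + (t * k) *\<^sub>R y"
      by (simp add: t k algebra_simps)
  qed (use t k in \<open>auto simp: algebra_simps\<close>)
qed

text \<open>When \<open>orient p q z\<close> vanishes, \<open>cnj (q - p) * (z - p)\<close> is real,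
  so \<open>z - p\<close> is a real multiple of \<open>q - p\<close>.\<close>

lemma orient_zero_line:
  assumes "orient p q z = 0" "p \<noteq> q"
  obtains k where "z = (1 - k) *\<^sub>R p + k *\<^sub>R q"
proof -
  define A where "A = Re (cnj (q - p) * (z - p))"
  define k where "k = A / (cmod (q - p))\<^sup>2"
  have "cnj (q - p) * (z - p) = of_real A"
    using assms(1) by (simp add: A_def orient_def complex_eq_iff)
  also have "A = k * (cmod (q - p))\<^sup>2" using assms(2) by (simp add: k_def)
  also have "of_real \<dots> = of_real k * ((q - p) * cnj (q - p))"
    by (simp only: of_real_mult complex_norm_square)
  finally have "cnj (q - p) * (z - p) = cnj (q - p) * (of_real k * (q - p))"
    by (simp add: mult_ac)
  hence "z - p = of_real k * (q - p)" using assms(2) by simp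
  hence "z = (1 - k) *\<^sub>R p + k *\<^sub>R q"
    by (simp add: scaleR_conv_of_real algebra_simps)
  thus ?thesis by (rule that)
qed

text \<open>On the line \<open>p w\<close>, parametrised by \<open>0\<close> at \<open>p\<close> and
  \<open>1\<close> at \<open>w\<close>, the ends \<open>g\<close> and \<open>h\<close> have
  parameters outside the open unit interval, while the common point \<open>z\<close> between them
  has its parameter inside. So they lie beyond opposite ends. This serves to show that a side
  running along a line of sight covers all of it.\<close>

lemma collinear_segment_subset:
  assumes z: "z \<in> open_segment p w" "z \<in> open_segment g h"
    and orient: "orient p w g = 0" "orient p w h = 0"
    and out: "g \<notin> open_segment p w" "h \<notin> open_segment p w"
  shows "closed_segment p w \<subseteq> closed_segment g h"
proof -
  have pw: "p \<noteq> w" using z by auto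
  let ?l = "\<lambda>k. (1 - k) *\<^sub>R p + k *\<^sub>R w"
  have inj: "?l i = ?l j \<longleftrightarrow> i = j" for i j
  proof
    assume "?l i = ?l j"
    hence "(i - j) *\<^sub>R (w - p) = 0" by (simp add: algebra_simps)
    thus "i = j" using pw by simp
  qed simp
  obtain i where i: "g = ?l i" using orient_zero_line[OF orient(1) pw] by blast
  obtain j where j: "h = ?l j" using orient_zero_line[OF orient(2) pw] by blast
  obtain k where k: "0 < k" "k < 1" "z = ?l k" using z by (auto elim: open_segmentE)
  obtain m where m: "0 < m" "m < 1" "z = (1 - m) *\<^sub>R g + m *\<^sub>R h"
    using z by (auto elim: open_segmentE)
  have "z = ?l ((1 - m) * i + m * j)" by (simp add: m i j algebra_simps)
  hence k_eq: "k = (1 - m) * i + m * j" using k inj by simp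
  have i01: "i \<le> 0 \<or> i \<ge> 1" using open_segmentI[of i g p w] i pw out by linarith
  have j01: "j \<le> 0 \<or> j \<ge> 1" using open_segmentI[of j h p w] j pw out by linarith
  have neg: "k \<le> 0" if "i \<le> 0" "j \<le> 0"
    using that m by (simp add: k_eq add_nonpos_nonpos mult_nonneg_nonpos)
  have pos: "1 \<le> k" if "1 \<le> i" "1 \<le> j"
  proof -
    have "(1 - m) * 1 + m * 1 \<le> (1 - m) * i + m * j"
      using that m by (intro add_mono mult_left_mono) auto
    thus ?thesis by (simp add: k_eq)
  qed
  have cases: "i \<le> 0 \<and> 1 \<le> j \<or> j \<le> 0 \<and> 1 \<le> i" using neg pos k i01 j01 by linarith
  have mem: "?l t \<in> closed_segment (?l a) (?l b)" if "a \<le> t" "t \<le> b" "a < b" for a b t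
  proof -
    define c where "c = (t - a) / (b - a)"
    have c: "0 \<le> c" "c \<le> 1" using that by (auto simp: c_def divide_le_eq)
    have t: "t = a + c * (b - a)" using that by (simp add: c_def)
    have "?l t = (1 - c) *\<^sub>R ?l a + c *\<^sub>R ?l b"
      unfolding t by (simp add: algebra_simps)
    thus ?thesis using c unfolding in_segment(1) by blast
  qed
  have l01: "?l 0 = p" "?l 1 = w" by simp_all
  have "p \<in> closed_segment g h \<and> w \<in> closed_segment g h"
    using cases
  proof
    assume "i \<le> 0 \<and> 1 \<le> j"
    thus ?thesis using mem[of i 0 j] mem[of i 1 j] unfolding l01 i j by simp
  next
    assume "j \<le> 0 \<and> 1 \<le> i"
    thus ?thesis using mem[of j 0 i] mem[of j 1 i]
      unfolding l01 i j closed_segment_commute[of "?l i"] by simp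
  qed
  thus ?thesis by (simp add: closed_segment_subset)
qed

text \<open>A small step from a point strictly inside the edge keeps the weights of \<open>p\<close>
  and \<open>y\<close> positive and makes that of \<open>x\<close> positive. Hence a side through
  \<open>z\<close> with an end on the flank of \<open>x\<close> would enter the triangle.\<close>

lemma leaves_edge_into_open_triangle:
  assumes z: "z \<in> open_segment p y" and side: "orient p y g * orient p y x > 0"
  shows "\<exists>e \<in> open_segment z g. e \<in> open_triangle p x y"
proof -
  obtain l where l: "0 < l" "l < 1" "z = (1 - l) *\<^sub>R p + l *\<^sub>R y"
    using z by (auto elim: open_segmentE)
  have "orient p y x \<noteq> 0" using side by auto
  then obtain a c b where abc: "a + c + b = 1" "g = a *\<^sub>R p + c *\<^sub>R y + b *\<^sub>R x"
    by (rule bary_exists)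
  have "orient p y g = b * orient p y x" unfolding abc(2) by (rule orient_bary[OF abc(1)])
  hence "0 < b * (orient p y x * orient p y x)" using side by (simp only: mult.assoc)
  moreover have "0 < orient p y x * orient p y x"
    using \<open>orient p y x \<noteq> 0\<close> not_real_square_gt_zero by blast
  ultimately have b: "b > 0" by (rule zero_less_mult_pos2)
  define d where "d = min (1 - l) l"
  \<comment> \<open>At \<open>z\<close> the weights of \<open>p\<close> and \<open>y\<close> are at
    least \<open>d\<close>. Mixing in \<open>g\<close> with weight \<open>e = d / n\<close> lowers
    them by at most \<open>e * d + e * (\<bar>a\<bar> + \<bar>c\<bar>)\<close>; the summand
    \<open>1\<close> in \<open>n\<close> leaves a margin of exactly \<open>e\<close>.\<close>
  define n where "n = d + 1 + \<bar>a\<bar> + \<bar>c\<bar>"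
  define e where "e = d / n"
  have d: "0 < d" "d \<le> 1 - l" "d \<le> l" using l by (auto simp: d_def)
  have n: "n > 0" "d < n" using d by (auto simp: n_def)
  have e: "0 < e" "e < 1" using d n by (auto simp: e_def)
  have en: "e * n = d" using n by (simp add: e_def)
  have key: "(1 - e) * t + e * q > 0" if "d \<le> t" "\<bar>q\<bar> \<le> \<bar>a\<bar> + \<bar>c\<bar>" for t q
  proof -
    have "e * q \<ge> e * (- (\<bar>a\<bar> + \<bar>c\<bar>))" using that e by (intro mult_left_mono) auto
    hence "e * q \<ge> - (e * (\<bar>a\<bar> + \<bar>c\<bar>))" by (simp only: mult_minus_right)
    moreover have "(1 - e) * t \<ge> (1 - e) * d" using that e by (intro mult_left_mono) auto
    moreover have "(1 - e) * d - e * (\<bar>a\<bar> + \<bar>c\<bar>) = e"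
      using en by (simp add: n_def algebra_simps)
    ultimately show ?thesis using e by linarith
  qed
  let ?w = "(1 - e) *\<^sub>R z + e *\<^sub>R g"
  have "?w \<in> open_triangle p x y"
  proof (rule open_triangleI)
    show "0 < (1 - e) * (1 - l) + e * a" using key d by simp
    show "0 < e * b" using e b by simp
    show "0 < (1 - e) * l + e * c" using key d by simp
    have "(1 - e) * (1 - l) + e * a + e * b + ((1 - e) * l + e * c) = (1 - e) + e * (a + c + b)"
      by (simp add: algebra_simps)
    thus "(1 - e) * (1 - l) + e * a + e * b + ((1 - e) * l + e * c) = 1" using abc by simp
    show "?w = ((1 - e) * (1 - l) + e * a) *\<^sub>R p + (e * b) *\<^sub>R x + ((1 - e) * l + e * c) *\<^sub>R y"
      unfolding l(3) abc(2) by (simp add: algebra_simps)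
  qed
  moreover have "z \<noteq> g"
  proof
    assume "z = g"
    moreover have "orient p y z = 0" unfolding l(3) by (simp add: orient_affine)
    ultimately show False using side by simp
  qed
  hence "?w \<in> open_segment z g" using e by (auto simp: in_segment)
  ultimately show ?thesis by blast
qed

text \<open>Multiplication by \<open>\<i>\<close> turns \<open>h - g\<close> by a right angle, so a
  short step in that direction leaves the line but not the open set.\<close>

lemma open_meets_off_line:
  assumes "open U" "y \<in> U" "g \<noteq> h"
  obtains y' where "y' \<in> U" "orient g h y' \<noteq> 0"
proof (cases "orient g h y = 0")
  case True
  obtain d where d: "d > 0" "ball y d \<subseteq> U"
    using assms(1,2) unfolding open_contains_ball by blast
  define c where "c = d / 2 / cmod (h - g)"
  have c: "c > 0" using d assms(3) by (simp add: c_def)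
  define y' where "y' = y + of_real c * (\<i> * (h - g))"
  have "dist y y' = c * cmod (h - g)" using c by (simp add: y'_def dist_norm norm_mult)
  also have "\<dots> = d / 2" using assms(3) by (simp add: c_def)
  finally have "y' \<in> U" using d by (intro subsetD[OF d(2)]) simp
  moreover have "orient g h y' = orient g h y + c * ((Re (h - g))\<^sup>2 + (Im (h - g))\<^sup>2)"
    by (simp add: orient_def y'_def power2_eq_square algebra_simps)
  hence "orient g h y' = orient g h y + c * (cmod (h - g))\<^sup>2" by (simp add: cmod_power2)
  hence "orient g h y' \<noteq> 0" using True c assms(3) by simp
  ultimately show ?thesis by (rule that)
qed (use assms that in blast)

lemma open_segment_subset:
  fixes a b c d :: complex
  assumes "a \<in> closed_segment c d" "b \<in> closed_segment c d"
  shows "open_segment a b \<subseteq> open_segment c d"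
  using assms by (simp add: subset_open_segment)

lemma orient_closed_segment_zero: "z \<in> closed_segment p q \<Longrightarrow> orient p q z = 0"
  by (auto elim!: closed_segmentE simp: orient_affine)

section \<open>Extending a bijection and comparing angles\<close>

lemma permutes_extending:
  assumes "finite U" "A \<subseteq> U" "inj_on f A" "f ` A \<subseteq> U"
  obtains p where "p permutes U" "\<And>x. x \<in> A \<Longrightarrow> p x = f x"
proof -
  have fA: "finite A" using assms finite_subset by blast
  have "card (U - A) = card (U - f ` A)"
    using assms fA by (simp add: card_Diff_subset card_image)
  then obtain h where h: "bij_betw h (U - A) (U - f ` A)"
    using finite_same_card_bij assms(1) by (metis finite_Diff)
  define p where "p x = (if x \<in> A then f x else if x \<in> U then h x else x)" for x
  have "bij_betw (\<lambda>x. if x \<in> A then f x else h x) (A \<union> (U - A)) (f ` A \<union> (U - f ` A))"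
    using assms(3) h by (intro bij_betw_disjoint_Un) (auto simp: bij_betw_def)
  moreover have "A \<union> (U - A) = U" "f ` A \<union> (U - f ` A) = U" using assms by auto
  ultimately have "bij_betw (\<lambda>x. if x \<in> A then f x else h x) U U" by simp
  hence "bij_betw p U U" by (rule bij_betw_cong[THEN iffD1, rotated]) (simp add: p_def)
  hence "p permutes U" using assms(2) by (intro bij_imp_permutes) (auto simp: p_def)
  thus ?thesis using that by (simp add: p_def)
qed

text \<open>The quotient \<open>z' / z\<close> has its argument strictly between \<open>0\<close>
  and \<open>pi\<close>. If adding it does not increase the argument, the sum has passed
  \<open>2 * pi\<close>, that is, the turn from \<open>z\<close> to \<open>z'\<close> reaches the
  positive real axis.\<close>

lemma Arg2pi_wraps:
  assumes "Im (cnj z * z') > 0" "Arg2pi z' \<le> Arg2pi z"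
  shows "Im z < 0" "Im z' \<ge> 0"
proof -
  have z: "z \<noteq> 0" "z' \<noteq> 0" using assms(1) by auto
  define q where "q = z' / z"
  have q: "z' = z * q" "q \<noteq> 0" using z by (auto simp: q_def)
  have "cnj z * z' = of_real ((cmod z)\<^sup>2) * q"
    unfolding q(1) complex_norm_square by (simp add: mult_ac)
  hence "Im (cnj z * z') = (cmod z)\<^sup>2 * Im q" by simp
  hence "Im q > 0" using assms(1) z by (simp add: zero_less_mult_iff)
  hence aq: "0 < Arg2pi q" "Arg2pi q < pi" using Arg2pi_lt_pi by auto
  have eq: "Arg2pi z' = (if Arg2pi z + Arg2pi q < 2 * pi then Arg2pi z + Arg2pi q
      else Arg2pi z + Arg2pi q - 2 * pi)"
    unfolding q(1) by (rule Arg2pi_times[OF z(1) q(2)])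
  have s: "\<not> Arg2pi z + Arg2pi q < 2 * pi" using eq assms(2) aq by auto
  have "Arg2pi z > pi" using s aq by linarith
  thus "Im z < 0" using Arg2pi_le_pi[of z] by linarith
  have "Arg2pi z < 2 * pi" by (rule Arg2pi_lt_2pi)
  hence "Arg2pi z' \<le> pi" using eq s aq by simp
  thus "Im z' \<ge> 0" using Arg2pi_le_pi by blast
qed

text \<open>The weights come from Cramer's rule with determinant \<open>D\<close>. The weight
  \<open>l\<close> vanishes exactly when \<open>z'\<close> itself lies on the positive real
  axis.\<close>

lemma Arg2pi_wraps_cone:
  assumes "Im (cnj z * z') > 0" "Arg2pi z' \<le> Arg2pi z"
  obtains l m where "0 \<le> l" "0 < m" "1 = l *\<^sub>R z + m *\<^sub>R z'"
proof -
  define D where "D = Im (cnj z * z')"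
  have D: "D > 0" "D = Re z * Im z' - Im z * Re z'" using assms(1) by (simp_all add: D_def)
  note w = Arg2pi_wraps[OF assms]
  show ?thesis
  proof (rule that)
    show "0 \<le> Im z' / D" "0 < - Im z / D" using w D(1) by (auto simp: divide_neg_pos)
    have "D *\<^sub>R 1 = Im z' *\<^sub>R z + (- Im z) *\<^sub>R z'"
      by (rule complex_eqI) (simp_all add: D(2) algebra_simps)
    hence "(1 / D) *\<^sub>R (D *\<^sub>R 1) = (1 / D) *\<^sub>R (Im z' *\<^sub>R z + (- Im z) *\<^sub>R z')" by (rule arg_cong)
    thus "1 = (Im z' / D) *\<^sub>R z + (- Im z / D) *\<^sub>R z'"
      using D(1) by (simp add: scaleR_diff_right)
  qed
qed

section \<open>The interior of a simple polygon\<close>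

locale simple_poly =
  fixes P :: "complex list"
  assumes simple: "simple_polygon P"
begin

abbreviation "V \<equiv> set P"
abbreviation "B \<equiv> polygon_boundary P"
abbreviation "I \<equiv> inside B"
abbreviation "R \<equiv> polygon_region P"

definition side :: "complex \<Rightarrow> complex \<Rightarrow> bool" where
  "side u v \<longleftrightarrow> {u, v} \<in> polygon_sides P"

section \<open>Incidence of vertices and sides along the cyclic list\<close>

lemma length_ge: "length P \<ge> 3" and distinct_P: "distinct P"
  using simple by (auto simp: simple_polygon_def)

lemma next_idx_less: "next_idx P i < length P"
  using length_ge by (auto simp: next_idx_def intro!: mod_less_divisor)

lemma next_idx_neq: "i < length P \<Longrightarrow> next_idx P i \<noteq> i"
  using length_ge by (cases "Suc i = length P") (auto simp: next_idx_def)

lemma next_idx_Suc: "Suc i < length P \<Longrightarrow> next_idx P i = Suc i"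
  by (simp add: next_idx_def)

lemma consecutive_sides:
  "i < length P \<Longrightarrow> side_seg P i \<inter> side_seg P (next_idx P i) = {P ! next_idx P i}"
  using simple by (auto simp: simple_polygon_def)

lemma nonconsecutive_sides:
  "i < length P \<Longrightarrow> j < length P \<Longrightarrow> i \<noteq> j \<Longrightarrow> j \<noteq> next_idx P i \<Longrightarrow> i \<noteq> next_idx P j
    \<Longrightarrow> side_seg P i \<inter> side_seg P j = {}"
  using simple by (auto simp: simple_polygon_def)

lemma side_sym: "side u v \<Longrightarrow> side v u"
  by (simp add: side_def insert_commute)

lemma side_cases:
  assumes "side g h"
  obtains i where "i < length P" "{g, h} = {P ! i, P ! next_idx P i}"
    "closed_segment g h = side_seg P i"
proof -
  obtain i where i: "i < length P" "{g, h} = {P ! i, P ! next_idx P i}"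
    using assms by (auto simp: side_def polygon_sides_def)
  hence "closed_segment g h = side_seg P i"
    by (auto simp: side_seg_def doubleton_eq_iff closed_segment_commute)
  with i show ?thesis using that by blast
qed

lemma side_nth: "i < length P \<Longrightarrow> side (P ! i) (P ! next_idx P i)"
  by (auto simp: side_def polygon_sides_def)

lemma side_ends: "side g h \<Longrightarrow> g \<in> V \<and> h \<in> V \<and> g \<noteq> h"
proof (elim side_cases)
  fix i assume i: "i < length P" "{g, h} = {P ! i, P ! next_idx P i}"
  have "P ! i \<noteq> P ! next_idx P i"
    using i(1) next_idx_less next_idx_neq distinct_P by (metis nth_eq_iff_index_eq)
  thus ?thesis using i next_idx_less by (auto simp: doubleton_eq_iff)
qed

lemma mem_B: "z \<in> B \<longleftrightarrow> (\<exists>g h. side g h \<and> z \<in> closed_segment g h)"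
proof
  assume "z \<in> B"
  thus "\<exists>g h. side g h \<and> z \<in> closed_segment g h"
    using side_nth by (fastforce simp: polygon_boundary_def side_seg_def)
next
  assume "\<exists>g h. side g h \<and> z \<in> closed_segment g h"
  thus "z \<in> B" by (auto simp: polygon_boundary_def elim!: side_cases)
qed

lemma side_subset_boundary: "side g h \<Longrightarrow> closed_segment g h \<subseteq> B"
  using mem_B by blast

lemma V_subset_B: "V \<subseteq> B"
proof
  fix w assume "w \<in> V"
  then obtain i where "i < length P" "w = P ! i" by (auto simp: in_set_conv_nth)
  thus "w \<in> B" using side_subset_boundary[OF side_nth] by auto
qed

lemma finite_sides: "finite {s. \<exists>g h. side g h \<and> s = closed_segment g h}"
proof (rule finite_subset)
  show "{s. \<exists>g h. side g h \<and> s = closed_segment g h} \<subseteq> side_seg P ` {..<length P}"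
    by (auto elim!: side_cases)
qed simp

lemma compact_B: "compact B"
  unfolding polygon_boundary_def side_seg_def by (intro compact_UN) auto

lemma closed_B: "closed B" by (rule compact_imp_closed[OF compact_B])

lemma side_vertex:
  assumes "side g h" "w \<in> V" "w \<in> closed_segment g h"
  shows "w = g \<or> w = h"
proof -
  obtain i where i: "i < length P" "{g, h} = {P ! i, P ! next_idx P i}"
    "closed_segment g h = side_seg P i" using assms(1) by (rule side_cases)
  obtain k where k: "k < length P" "w = P ! k" using assms(2) by (auto simp: in_set_conv_nth)
  have w: "w \<in> side_seg P k \<inter> side_seg P i" using assms(3) i k by (auto simp: side_seg_def)
  have "k = i \<or> k = next_idx P i"
  proof (rule ccontr)
    assume n: "\<not> ?thesis"
    show False
    proof (cases "i = next_idx P k")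
      case True
      hence "w = P ! i" using consecutive_sides[OF k(1)] w by auto
      thus False using n k i distinct_P by (simp add: nth_eq_iff_index_eq)
    next
      case False
      thus False using nonconsecutive_sides[of k i] n w k i by auto
    qed
  qed
  hence "w \<in> {g, h}" using i(2) k(2) by auto
  thus ?thesis by blast
qed

lemma side_inter:
  assumes "side g h" "side g' h'" "z \<in> closed_segment g h" "z \<in> closed_segment g' h'" "z \<notin> V"
  shows "{g, h} = {g', h'}"
proof -
  obtain i where i: "i < length P" "{g, h} = {P ! i, P ! next_idx P i}"
    "closed_segment g h = side_seg P i" using assms(1) by (rule side_cases)
  obtain j where j: "j < length P" "{g', h'} = {P ! j, P ! next_idx P j}"
    "closed_segment g' h' = side_seg P j" using assms(2) by (rule side_cases)
  have z: "z \<in> side_seg P i \<inter> side_seg P j" using assms i j by simp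
  have nV: "P ! next_idx P k \<in> V" for k using next_idx_less by simp
  have "i = j"
  proof (rule ccontr)
    assume "i \<noteq> j"
    then consider "j = next_idx P i" | "i = next_idx P j"
      using nonconsecutive_sides[of i j] i j z by auto
    hence "z = P ! next_idx P i \<or> z = P ! next_idx P j"
      using consecutive_sides[OF i(1)] consecutive_sides[OF j(1)] z by cases auto
    thus False using nV assms(5) by blast
  qed
  thus ?thesis using i j by simp
qed

section \<open>The boundary as a Jordan curve\<close>

lemma boundary_arc:
  assumes "1 \<le> k" "k < length P"
  shows "\<exists>g. arc g \<and> pathstart g = P ! 0 \<and> pathfinish g = P ! k \<and>
    path_image g = (\<Union>i<k. side_seg P i)"
  using assms
proof (induction k rule: dec_induct)
  case base
  have "0 < length P" "1 < length P" using length_ge by linarith+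
  hence "P ! 0 \<noteq> P ! 1" using distinct_P by (simp add: nth_eq_iff_index_eq)
  moreover have "next_idx P 0 = 1" using length_ge by (simp add: next_idx_Suc)
  ultimately show ?case
    by (intro exI[of _ "linepath (P ! 0) (P ! 1)"]) (auto simp: side_seg_def)
next
  case (step k)
  then obtain g where g: "arc g" "pathstart g = P ! 0" "pathfinish g = P ! k"
    "path_image g = (\<Union>i<k. side_seg P i)" by auto
  let ?l = "linepath (P ! k) (P ! Suc k)"
  have nk: "next_idx P k = Suc k" using step by (simp add: next_idx_Suc)
  have l: "path_image ?l = side_seg P k" by (simp add: side_seg_def nk)
  have "side_seg P i \<inter> side_seg P k \<subseteq> {P ! k}" if "i < k" for i
  proof (cases "Suc i = k")
    case True
    thus ?thesis using consecutive_sides[of i] step by (auto simp: next_idx_Suc)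
  next
    case False
    thus ?thesis using nonconsecutive_sides[of i k] step that by (auto simp: next_idx_Suc)
  qed
  hence "path_image g \<inter> path_image ?l \<subseteq> {pathstart ?l}"
    unfolding g(4) l by auto
  moreover have "arc ?l" using distinct_P step by (auto simp: nth_eq_iff_index_eq)
  ultimately have "arc (g +++ ?l)" using g by (intro arc_join) auto
  moreover have "path_image (g +++ ?l) = (\<Union>i<Suc k. side_seg P i)"
    using g l by (auto simp: path_image_join lessThan_Suc)
  ultimately show ?case using g by (intro exI[of _ "g +++ ?l"]) auto
qed

text \<open>All sides but the closing one form an arc, and the closing side meets it only in its two
  ends; the neighbours of that side at either end and the disjoint remaining sides are treated
  apart. This makes the Jordan curve theorem applicable.\<close>

lemma boundary_simple_path:
  "\<exists>g. simple_path g \<and> pathfinish g = pathstart g \<and> path_image g = B"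
proof -
  define m where "m = length P - 1"
  have m: "length P = Suc m" "2 \<le> m" using length_ge by (auto simp: m_def)
  obtain g where g: "arc g" "pathstart g = P ! 0" "pathfinish g = P ! m"
    "path_image g = (\<Union>i<m. side_seg P i)" using boundary_arc[of m] m by auto
  let ?l = "linepath (P ! m) (P ! 0)"
  have nm: "next_idx P m = 0" using m by (simp add: next_idx_def)
  have l: "path_image ?l = side_seg P m" by (simp add: side_seg_def nm)
  have "side_seg P i \<inter> side_seg P m \<subseteq> {P ! 0, P ! m}" if "i < m" for i
  proof -
    have ni: "next_idx P i = Suc i" using m that by (simp add: next_idx_Suc)
    consider "Suc i = m" | "i = 0" | "Suc i \<noteq> m" "i \<noteq> 0" by blast
    thus ?thesis
    proof cases
      case 1 thus ?thesis using consecutive_sides[of i] m that ni by auto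
    next
      case 2 thus ?thesis using consecutive_sides[of m] m nm by auto
    next
      case 3 thus ?thesis using nonconsecutive_sides[of i m] m nm that ni by auto
    qed
  qed
  hence "path_image g \<inter> path_image ?l \<subseteq> {pathstart g, pathstart ?l}"
    unfolding g l by auto
  moreover have "arc ?l" using distinct_P m by (auto simp: nth_eq_iff_index_eq)
  ultimately have "simple_path (g +++ ?l)" using g by (intro simple_path_join_loop) auto
  moreover have "path_image (g +++ ?l) = B"
    using g l m by (auto simp: path_image_join lessThan_Suc polygon_boundary_def)
  ultimately show ?thesis using g by (intro exI[of _ "g +++ ?l"]) auto
qed

lemma open_I: "open I" and bounded_I: "bounded I"
  and frontier_I: "frontier I = B" and frontier_outside_B: "frontier (outside B) = B"
  using boundary_simple_path Jordan_inside_outside by metis+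

lemma B_Int_I [simp]: "B \<inter> I = {}" using inside_no_overlap[of B] by blast

lemma R_eq: "R = B \<union> I" by (simp add: polygon_region_def)

lemma B_subset_closure_I: "B \<subseteq> closure I"
  using frontier_I by (auto simp: frontier_def)

text \<open>By the Jordan curve theorem every boundary point is a limit of exterior points.\<close>

lemma open_subset_R:
  assumes "open U" "U \<subseteq> R" shows "U \<subseteq> I"
proof -
  have "U \<inter> outside B = {}"
    using assms(2) outside_inside[of B] by (auto simp: R_eq)
  hence "U \<inter> closure (outside B) = {}"
    using assms(1) by (simp add: open_Int_closure_eq_empty)
  thus ?thesis using assms(2) frontier_outside_B by (auto simp: R_eq frontier_def)
qed

lemma connected_subset_I:
  assumes "connected C" "C \<inter> B = {}" "C \<inter> I \<noteq> {}" shows "C \<subseteq> I"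
proof (rule ccontr)
  assume "\<not> C \<subseteq> I"
  hence "C \<inter> frontier I \<noteq> {}" using assms by (intro connected_Int_frontier) auto
  thus False using assms frontier_I by simp
qed

text \<open>The region has no holes: the component of a point of \<open>K\<close> outside the region
  is unbounded, so it leaves \<open>K\<close> through the frontier, and there it would meet the
  region.\<close>

lemma compact_subset_R:
  assumes "compact K" "frontier K \<subseteq> R" shows "K \<subseteq> R"
proof
  fix z assume z: "z \<in> K"
  show "z \<in> R"
  proof (rule ccontr)
    assume nz: "z \<notin> R"
    let ?C = "connected_component_set (- B) z"
    have out: "z \<in> outside B" using nz outside_inside[of B] by (auto simp: R_eq)
    hence "\<not> bounded ?C" by (simp add: outside)
    hence "\<not> ?C \<subseteq> K" using assms(1) bounded_subset compact_imp_bounded by blast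
    moreover have "z \<in> ?C" using nz by (simp add: R_eq)
    ultimately have "?C \<inter> K \<noteq> {}" "?C - K \<noteq> {}" using z by blast+
    hence "?C \<inter> frontier K \<noteq> {}" by (intro connected_Int_frontier) auto
    then obtain y where y: "y \<in> ?C" "y \<in> R" using assms(2) by blast
    have "y \<in> outside B" using y out
      by (metis mem_Collect_eq outside_same_component)
    thus False using y(2) outside_inside[of B] by (auto simp: R_eq)
  qed
qed

section \<open>Clean lines of sight\<close>

text \<open>The visibility graph also has sight lines that touch the boundary between their ends; these
  are left out.\<close>

definition edge :: "complex \<Rightarrow> complex \<Rightarrow> bool" where
  "edge u v \<longleftrightarrow> u \<in> V \<and> v \<in> V \<and> u \<noteq> v \<and> (open_segment u v \<subseteq> I \<or> side u v)"

lemma edge_sym: "edge u v \<Longrightarrow> edge v u"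
  by (auto simp: edge_def open_segment_commute side_sym)

lemma V_not_I: "w \<in> V \<Longrightarrow> w \<notin> I"
  using V_subset_B B_Int_I by blast

lemma side_edge: "side u v \<Longrightarrow> edge u v"
  using side_ends by (simp add: edge_def)

lemma edge_subset_R: "edge u v \<Longrightarrow> closed_segment u v \<subseteq> R"
  using side_subset_boundary V_subset_B by (auto simp: edge_def R_eq closed_segment_eq_open)

lemma edge_vis_adj: "edge u v \<Longrightarrow> vis_adj P u v"
  using edge_subset_R by (auto simp: vis_adj_def visible_def edge_def)

lemma edge_no_vertex:
  assumes "edge u v" "w \<in> V" shows "w \<notin> open_segment u v"
proof
  assume w: "w \<in> open_segment u v"
  hence "side u v" using assms V_not_I by (auto simp: edge_def)
  thus False using side_vertex[of u v w] assms w by (auto simp: open_segment_def)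
qed

text \<open>A clean edge that touches the boundary strictly between its ends is a side, and two
  sides that share a point other than a vertex are equal.\<close>

lemma edge_side:
  assumes "edge u v" "z \<in> open_segment u v" "side g h" "z \<in> closed_segment g h"
  shows "{g, h} = {u, v}"
proof -
  have "z \<in> B" using assms mem_B by blast
  hence "z \<notin> I" using B_Int_I by blast
  hence "side u v" using assms by (auto simp: edge_def)
  moreover have "z \<notin> V" using edge_no_vertex assms by blast
  ultimately show ?thesis using side_inter assms by (auto simp: open_segment_def)
qed

text \<open>An open convex set together with any part of its closure is connected, so one interior
  point decides for the whole union. The set \<open>K\<close> admits that the known point, or the
  segment of interest, lies on the border of the triangle.\<close>

lemma open_triangle_Un_subset_I:
  assumes nc: "orient p q r \<noteq> 0" and "open_triangle p q r \<inter> B = {}" "K \<subseteq> convex hull {p, q, r}"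
    "K \<inter> B = {}" "K \<inter> I \<noteq> {} \<or> open_triangle p q r \<inter> I \<noteq> {}"
  shows "open_triangle p q r \<union> K \<subseteq> I"
proof (rule connected_subset_I)
  show "connected (open_triangle p q r \<union> K)"
  proof (rule connected_intermediate_closure)
    show "connected (open_triangle p q r)" by (rule convex_connected[OF convex_open_triangle[OF nc]])
    show "open_triangle p q r \<union> K \<subseteq> closure (open_triangle p q r)"
      using assms(3) open_triangle_subset_hull by (simp add: closure_open_triangle[OF nc])
  qed simp
qed (use assms in auto)

text \<open>The border of the triangle lies in the region, so the region, having no holes, contains
  the triangle; an open part of the region is interior.\<close>

lemma open_triangle_subset_I:
  assumes "edge p q" "edge q r" "edge r p" and nc: "orient p q r \<noteq> 0"
  shows "open_triangle p q r \<subseteq> I"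
proof -
  have "frontier (convex hull {p, q, r}) \<subseteq> R"
    unfolding frontier_hull3[OF nc] using assms(1-3)[THEN edge_subset_R] by (intro Un_least)
  moreover have "compact (convex hull {p, q, r})"
    by (rule compact_convex_hull[OF finite_imp_compact]) simp
  ultimately have "convex hull {p, q, r} \<subseteq> R"
    using compact_subset_R by blast
  with open_triangle_subset_hull have "open_triangle p q r \<subseteq> R" by (rule subset_trans)
  thus ?thesis by (rule open_subset_R[OF open_open_triangle[OF nc]])
qed

text \<open>In a small disc about a point strictly inside a side the boundary is just that side, so
  each open half disc is connected off the boundary. The factor \<open>s\<close> selects the half,
  and one radius serves for every \<open>s\<close>.\<close>

lemma side_half_balls:
  assumes side: "side g h" and z: "z \<in> open_segment g h"
  obtains e where "e > 0"
    "\<And>s. \<exists>y \<in> R. dist z y < e \<and> s * orient g h y > 0 \<Longrightarrow> ball z e \<inter> {y. s * orient g h y > 0} \<subseteq> I"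
proof -
  note result = that
  have zV: "z \<notin> V" using side_vertex[OF side] z by (auto simp: open_segment_def)
  \<comment> \<open>The union of all sides that miss \<open>z\<close> is closed because they are
    finitely many, so some disc about \<open>z\<close> avoids it.\<close>
  let ?C = "\<Union>{s. (\<exists>g' h'. side g' h' \<and> s = closed_segment g' h') \<and> z \<notin> s}"
  have "finite {s. (\<exists>g' h'. side g' h' \<and> s = closed_segment g' h') \<and> z \<notin> s}"
    by (rule finite_subset[OF _ finite_sides]) auto
  hence "closed ?C" by (intro closed_Union) auto
  hence "open (- ?C)" by (rule open_Compl)
  then obtain e where e: "e > 0" "ball z e \<subseteq> - ?C"
    unfolding open_contains_ball by blast
  have sub: "ball z e \<inter> B \<subseteq> closed_segment g h"
  proof
    fix y assume y: "y \<in> ball z e \<inter> B"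
    then obtain g' h' where g': "side g' h'" "y \<in> closed_segment g' h'" using mem_B by blast
    have "z \<in> closed_segment g' h'" using y e g' by blast
    hence "{g', h'} = {g, h}" using side_inter[OF g'(1) side] z zV by (auto simp: open_segment_def)
    hence "closed_segment g' h' = closed_segment g h"
      by (auto simp: doubleton_eq_iff closed_segment_commute)
    thus "y \<in> closed_segment g h" using g' by blast
  qed
  have seg0: "orient g h y = 0" if "y \<in> closed_segment g h" for y
    using that by (auto elim!: closed_segmentE simp: orient_affine)
  have half: "ball z e \<inter> {y. s * orient g h y > 0} \<subseteq> I"
    if ex: "\<exists>y \<in> R. dist z y < e \<and> s * orient g h y > 0" for s
  proof (rule connected_subset_I)
    have "convex {y. s * orient g h y > 0}"
    proof (rule convexI)
      fix y1 y2 and a b :: real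
      assume a: "y1 \<in> {y. s * orient g h y > 0}" "y2 \<in> {y. s * orient g h y > 0}" "0 \<le> a" "0 \<le> b" "a + b = 1"
      have "s * orient g h (a *\<^sub>R y1 + b *\<^sub>R y2) = a * (s * orient g h y1) + b * (s * orient g h y2)"
        by (simp add: orient_affine[OF a(5)] algebra_simps)
      moreover have "\<dots> > 0"
      proof (cases "a = 0")
        case True thus ?thesis using a by simp
      next
        case False thus ?thesis using a by (intro add_pos_nonneg) auto
      qed
      ultimately show "a *\<^sub>R y1 + b *\<^sub>R y2 \<in> {y. s * orient g h y > 0}" by simp
    qed
    thus "connected (ball z e \<inter> {y. s * orient g h y > 0})"
      by (intro convex_connected convex_Int) auto
    show "ball z e \<inter> {y. s * orient g h y > 0} \<inter> B = {}" using sub seg0 by fastforce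
    obtain y where y: "y \<in> R" "y \<in> ball z e" "s * orient g h y > 0" using ex by auto
    hence "y \<notin> B" using sub seg0 by fastforce
    hence "y \<in> I" using y by (simp add: R_eq)
    thus "ball z e \<inter> {y. s * orient g h y > 0} \<inter> I \<noteq> {}" using y by auto
  qed
  show thesis by (rule result[OF e(1) half])
qed

text \<open>With both half discs interior, the disc would contain no exterior point at all, since
  the exterior is open and would reach off the line \<open>g h\<close>. But then the whole disc,
  including the boundary point \<open>z\<close>, would be interior.\<close>

lemma not_R_on_both_sides:
  assumes side: "side g h" and z: "z \<in> open_segment g h"
    and pos: "\<And>e. e > 0 \<Longrightarrow> \<exists>y \<in> R. dist z y < e \<and> orient g h y > 0"
    and neg: "\<And>e. e > 0 \<Longrightarrow> \<exists>y \<in> R. dist z y < e \<and> orient g h y < 0"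
  shows False
proof -
  have gh: "g \<noteq> h" using side_ends side by blast
  obtain e where e: "e > 0"
    and half: "\<And>s. \<exists>y \<in> R. dist z y < e \<and> s * orient g h y > 0
      \<Longrightarrow> ball z e \<inter> {y. s * orient g h y > 0} \<subseteq> I"
    using side_half_balls[OF side z] by blast
  have off: "y \<in> I" if "y \<in> ball z e" "orient g h y \<noteq> 0" for y
    using that half[of 1] half[of "-1"] pos[OF e] neg[OF e] by (cases "orient g h y > 0") auto
  have "ball z e \<inter> outside B = {}"
  proof (rule ccontr)
    assume "ball z e \<inter> outside B \<noteq> {}"
    then obtain y where y: "y \<in> ball z e \<inter> outside B" by blast
    have "open (ball z e \<inter> outside B)" using closed_B by (intro open_Int open_outside) auto
    then obtain y' where "y' \<in> ball z e \<inter> outside B" "orient g h y' \<noteq> 0"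
      using open_meets_off_line y gh by metis
    thus False using off[of y'] inside_Int_outside by blast
  qed
  hence "ball z e \<subseteq> I"
    using outside_inside[of B] by (intro open_subset_R) (auto simp: R_eq)
  moreover have "z \<in> B" using side_subset_boundary[OF side] z by (auto simp: open_segment_def)
  moreover have "z \<in> ball z e" using e by simp
  ultimately show False using B_Int_I by blast
qed

text \<open>Rotating a ray about \<open>p\<close> from \<open>p x\<close> towards \<open>p r\<close>, \<open>w\<close> is the first vertex that it meets in
  the triangle \<open>p x r\<close>, and \<open>y\<close> is the point where the ray then leaves the triangle.\<close>

lemma sweep:
  assumes nc: "orient p x r \<noteq> 0"
    and sides: "\<And>g h. side g h \<Longrightarrow>
      closed_segment g h \<inter> (closed_segment p x \<union> closed_segment x r) \<subseteq> {p, r} \<or>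
      closed_segment g h \<inter> open_triangle p x r = {}"
    and free: "open_segment p x \<subseteq> I \<or> open_segment x r \<subseteq> I"
    and w0: "w0 \<in> V" "w0 \<in> convex hull {p, x, r}" "orient p x w0 \<noteq> 0"
  obtains w y where "w \<in> V" "y \<in> open_segment x r \<or> y = r" "w \<in> open_segment p y \<or> w = y"
    "open_triangle p x y \<subseteq> I" "open_segment p w \<inter> V = {}"
    "open_segment p w \<subseteq> I \<or> (\<exists>g h. side g h \<and> closed_segment p w \<subseteq> closed_segment g h)"
    "p \<noteq> w"
proof -
  define D where "D = orient p x r"
  have D: "D \<noteq> 0" using nc by (simp add: D_def)
  \<comment> \<open>\<open>c\<close> and \<open>a\<close> are the barycentric coordinates belonging
    to \<open>r\<close> and \<open>p\<close>. The ray from \<open>p\<close> through \<open>w\<close>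
    hits \<open>x r\<close> at the parameter \<open>t w\<close>, which therefore serves as the angle
    of the rotating ray.\<close>
  define c where "c w = orient p x w / D" for w
  define a where "a w = orient x r w / D" for w
  define t where "t w = c w / (1 - a w)" for w
  define W where "W = {w \<in> V. w \<in> convex hull {p, x, r} \<and> orient p x w \<noteq> 0}"
  have coord: "c w = k \<and> a w = i" if "i + j + k = 1" "w = i *\<^sub>R p + j *\<^sub>R x + k *\<^sub>R r" for w i j k
  proof -
    have "orient p x w = k * D" unfolding that(2) D_def by (rule orient_bary[OF that(1)])
    moreover have "w = j *\<^sub>R x + k *\<^sub>R r + i *\<^sub>R p" "j + k + i = 1" using that by simp_all
    hence "orient x r w = i * orient x r p" using orient_bary by metis
    hence "orient x r w = i * D" using orient_rotate[of p x r] by (simp add: D_def)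
    ultimately show ?thesis using D by (simp add: c_def a_def)
  qed
  have W_coord: "\<exists>i j k. 0 \<le> i \<and> 0 \<le> j \<and> 0 < k \<and> i + j + k = 1 \<and>
      w = i *\<^sub>R p + j *\<^sub>R x + k *\<^sub>R r \<and> c w = k \<and> a w = i \<and> t w = k / (j + k)" if w: "w \<in> W" for w
  proof -
    obtain i j k where ijk: "0 \<le> i" "0 \<le> j" "0 \<le> k" "i + j + k = 1" "w = i *\<^sub>R p + j *\<^sub>R x + k *\<^sub>R r"
      using w unfolding W_def in_hull3 by blast
    have ca: "c w = k" "a w = i" using coord[OF ijk(4,5)] by auto
    have "k \<noteq> 0" using w ca D by (auto simp: W_def c_def)
    moreover have "1 - i = j + k" using ijk by simp
    ultimately show ?thesis using ijk ca by (intro exI[of _ i] exI[of _ j] exI[of _ k]) (simp add: t_def)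
  qed
  have finW: "finite W" "W \<noteq> {}" using w0 by (auto simp: W_def)
  define t0 where "t0 = Min (t ` W)"
  have t0: "t0 \<le> t w" if "w \<in> W" for w using that finW by (simp add: t0_def)
  define W' where "W' = {w \<in> W. t w = t0}"
  have "t0 \<in> t ` W" using finW by (simp add: t0_def)
  hence finW': "finite W'" "W' \<noteq> {}" using finW by (auto simp: W'_def)
  \<comment> \<open>Several vertices may lie on the first ray that meets one. The largest weight on
    \<open>p\<close> singles out the nearest of them.\<close>
  define a0 where "a0 = Max (a ` W')"
  have a0: "a w \<le> a0" if "w \<in> W'" for w using that finW' by (simp add: a0_def)
  have "a0 \<in> a ` W'" using finW' by (simp add: a0_def)
  then obtain w where w: "w \<in> W" "t w = t0" "a w = a0" by (auto simp: W'_def)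
  obtain i j k where ijk: "0 \<le> i" "0 \<le> j" "0 < k" "i + j + k = 1"
    "w = i *\<^sub>R p + j *\<^sub>R x + k *\<^sub>R r" "c w = k" "a w = i" "t w = k / (j + k)"
    using W_coord[OF w(1)] by blast
  have t0_eq: "t0 = k / (j + k)" using w ijk by simp
  have t01: "0 < t0" "t0 \<le> 1" using ijk by (auto simp: t0_eq)
  define y where "y = (1 - t0) *\<^sub>R x + t0 *\<^sub>R r"
  have xr: "x \<noteq> r" "p \<noteq> x" using nc by auto
  have y: "y \<in> open_segment x r \<or> y = r"
  proof (cases "t0 = 1")
    case False thus ?thesis using t01 xr by (intro disjI1 open_segmentI[of t0]) (auto simp: y_def)
  qed (simp add: y_def)
  have cy: "orient p x y = t0 * D" by (simp add: y_def orient_affine D_def)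
  have ncy: "orient p x y \<noteq> 0" using cy t01 D by simp
  have kt: "k = (j + k) * t0" "j = (j + k) * (1 - t0)"
    using ijk by (simp_all add: t0_eq field_simps)
  have w_eq: "w = i *\<^sub>R p + (1 - i) *\<^sub>R y"
  proof -
    have "(1 - i) *\<^sub>R y = ((j + k) * (1 - t0)) *\<^sub>R x + ((j + k) * t0) *\<^sub>R r"
    proof -
      have "1 - i = j + k" using ijk(4) by simp
      thus ?thesis by (simp only: y_def scaleR_add_right scaleR_scaleR)
    qed
    thus ?thesis using ijk(5) kt by simp
  qed
  have py: "p \<noteq> y" using ncy by auto
  have i1: "i < 1" using ijk by simp
  have wy: "w \<in> open_segment p y \<or> w = y"
  proof (cases "i = 0")
    case False
    thus ?thesis using ijk i1 py by (intro disjI1 open_segmentI[of "1 - i"]) (auto simp: w_eq)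
  qed (simp add: w_eq)
  have in_W: "v \<in> W" if "v \<in> V" "0 \<le> i'" "0 \<le> j'" "0 < k'" "i' + j' + k' = 1"
      "v = i' *\<^sub>R p + j' *\<^sub>R x + k' *\<^sub>R r" for v i' j' k'
  proof -
    have "c v = k'" using coord that by blast
    hence "orient p x v \<noteq> 0" using that(4) by (auto simp: c_def)
    moreover have "v \<in> convex hull {p, x, r}"
      using that by (intro in_hull3I[of i' j' k']) auto
    ultimately show ?thesis using that by (simp add: W_def)
  qed
  \<comment> \<open>A vertex strictly inside the swept triangle would be met at a smaller parameter
    than \<open>t0\<close>.\<close>
  have noV: "v \<notin> open_triangle p x y" if "v \<in> V" for v
  proof
    assume "v \<in> open_triangle p x y"
    then obtain i' j' k' where v: "0 < i'" "0 < j'" "0 < k'" "i' + j' + k' = 1"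
      "v = i' *\<^sub>R p + j' *\<^sub>R x + k' *\<^sub>R y" by (rule open_triangleE)
    have v': "v = i' *\<^sub>R p + (j' + k' * (1 - t0)) *\<^sub>R x + (k' * t0) *\<^sub>R r"
      by (simp add: v y_def algebra_simps)
    have s1: "i' + (j' + k' * (1 - t0)) + k' * t0 = 1" using v by (simp add: algebra_simps)
    have pos: "0 \<le> j' + k' * (1 - t0)" "0 < k' * t0" using v t01 by auto
    have "v \<in> W" using in_W[OF that _ pos s1 v'] v by simp
    hence "t0 \<le> t v" by (rule t0)
    moreover have "t v = k' * t0 / (1 - i')" using coord[OF s1 v'] by (simp add: t_def)
    moreover have "1 - i' = j' + k'" using v by simp
    ultimately have "t0 \<le> k' * t0 / (j' + k')" by metis
    hence "t0 * (j' + k') \<le> k' * t0" using v by (simp add: pos_le_divide_eq)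
    hence "t0 * j' \<le> 0" by (simp add: algebra_simps)
    thus False using t01 v by (simp add: mult_le_0_iff)
  qed
  have sub: "open_triangle p x y \<subseteq> open_triangle p x r" using y open_triangle_mono by blast
  have "closed_segment g h \<inter> open_triangle p x y = {}" if gh: "side g h" for g h
    using sides[OF gh]
  proof
    assume m: "closed_segment g h \<inter> (closed_segment p x \<union> closed_segment x r) \<subseteq> {p, r}"
    show ?thesis
    proof (rule segment_avoids_open_triangle[OF ncy])
      show "g \<notin> open_triangle p x y" "h \<notin> open_triangle p x y" using noV side_ends[OF gh] by auto
      have "y \<in> closed_segment x r" using y by (auto simp: open_segment_def)
      hence xy: "closed_segment x y \<subseteq> closed_segment x r" by (simp add: subset_closed_segment)
      have "r = y" if ry: "r \<in> closed_segment x y"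
      proof -
        obtain q where q: "0 \<le> q" "q \<le> 1" "r = (1 - q) *\<^sub>R x + q *\<^sub>R y"
          using ry by (rule closed_segmentE)
        have "D = q * (t0 * D)" unfolding cy[symmetric] by (simp add: D_def q(3) orient_affine)
        hence "q * t0 = 1" using D by simp
        moreover have "q * t0 \<le> t0" using q t01 mult_right_mono[of q 1 t0] by simp
        ultimately have "t0 = 1" using t01 by linarith
        thus ?thesis by (simp add: y_def)
      qed
      moreover have "r \<notin> closed_segment p x"
      proof
        assume "r \<in> closed_segment p x"
        hence "orient p x r = 0" by (auto elim!: closed_segmentE simp: orient_affine)
        thus False using nc by simp
      qed
      ultimately have "z = p \<or> z = y"
        if z: "z \<in> closed_segment g h" "z \<in> closed_segment p x \<or> z \<in> closed_segment x y" for z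
      proof -
        have "z \<in> {p, r}" using m z xy by (meson IntI UnI1 UnI2 subsetD)
        thus ?thesis using z \<open>r \<notin> closed_segment p x\<close> \<open>r \<in> closed_segment x y \<Longrightarrow> r = y\<close> by auto
      qed
      thus "closed_segment g h \<inter> (closed_segment p x \<union> closed_segment x y) \<subseteq> {p, y}"
        by auto
    qed
  next
    assume "closed_segment g h \<inter> open_triangle p x r = {}" thus ?thesis using sub by blast
  qed
  hence tB: "open_triangle p x y \<inter> B = {}" using mem_B by blast
  have tI: "open_triangle p x y \<subseteq> I"
  proof -
    \<comment> \<open>The assumption \<open>free\<close> provides an interior point on the border of
      the swept triangle, the midpoint of \<open>p x\<close> or of \<open>x y\<close>; it decides
      that the triangle is interior and not exterior.\<close>
    have "\<exists>m. m \<in> I \<and> m \<in> convex hull {p, x, y}"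
    proof (cases "open_segment p x \<subseteq> I")
      case True
      have "midpoint p x \<in> open_segment p x" using xr by simp
      moreover have "midpoint p x \<in> convex hull {p, x, y}"
        by (intro in_hull3I[of "1/2" "1/2" 0]) (auto simp: midpoint_def algebra_simps)
      ultimately show ?thesis using True by blast
    next
      case False
      hence xrI: "open_segment x r \<subseteq> I" using free by blast
      have xy: "x \<noteq> y" using ncy by auto
      have "midpoint x y \<in> open_segment x y" using xy by simp
      moreover have "open_segment x y \<subseteq> open_segment x r"
        using y by (metis ends_in_segment(1) open_closed_segment order_refl subset_open_segment)
      moreover have "midpoint x y \<in> convex hull {p, x, y}"
        by (intro in_hull3I[of 0 "1/2" "1/2"]) (auto simp: midpoint_def algebra_simps)
      ultimately show ?thesis using xrI by blast
    qed
    then obtain m where m: "m \<in> I" "m \<in> convex hull {p, x, y}" by blast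
    have "m \<notin> B" using m B_Int_I by blast
    hence "open_triangle p x y \<union> {m} \<subseteq> I" using m by (intro open_triangle_Un_subset_I[OF ncy tB]) auto
    thus ?thesis by simp
  qed
  have pw: "p \<noteq> w"
  proof
    assume "p = w"
    moreover have "(1 - i) *\<^sub>R (y - p) = w - p"
      unfolding w_eq by (simp only: scaleR_diff_right scaleR_diff_left scaleR_one) simp
    ultimately have "(1 - i) *\<^sub>R (y - p) = 0" by (simp only: diff_self)
    thus False using i1 py by (simp only: scaleR_eq_0_iff right_minus_eq) auto
  qed
  have pwy: "open_segment p w \<subseteq> open_segment p y"
    using wy by (meson ends_in_segment(1) open_closed_segment subset_open_segment subset_refl)
  have noV': "open_segment p w \<inter> V = {}"
  proof (rule ccontr)
    assume "open_segment p w \<inter> V \<noteq> {}"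
    then obtain v where v: "v \<in> V" "v \<in> open_segment p w" by blast
    obtain q where q: "0 < q" "q < 1" "v = (1 - q) *\<^sub>R p + q *\<^sub>R w"
      using v(2) by (auto elim: open_segmentE)
    have s1: "(1 - q + q * i) + q * j + q * k = 1"
    proof -
      have "(1 - q + q * i) + q * j + q * k = 1 - q + q * (i + j + k)" by (simp add: algebra_simps)
      thus ?thesis using ijk by simp
    qed
    have v': "v = (1 - q + q * i) *\<^sub>R p + (q * j) *\<^sub>R x + (q * k) *\<^sub>R r"
      unfolding q(3) ijk(5) by (simp add: algebra_simps)
    have cv: "c v = q * k" "a v = 1 - q + q * i" using coord[OF s1 v'] by auto
    have "v \<in> W" using in_W[OF v(1) _ _ _ s1 v'] q ijk by simp
    moreover have "t v = t0"
    proof -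
      have "1 - a v = q * (j + k)" using s1 cv by (simp add: algebra_simps)
      thus ?thesis using cv q by (simp add: t_def t0_eq)
    qed
    ultimately have "a v \<le> a0" using a0 by (simp add: W'_def)
    hence "1 - q + q * i \<le> i" using cv w ijk by simp
    hence "(1 - q) * (1 - i) \<le> 0" by (simp add: algebra_simps)
    thus False using q i1 by (simp add: mult_le_0_iff)
  qed
  have "open_segment p w \<subseteq> I \<or> (\<exists>g h. side g h \<and> closed_segment p w \<subseteq> closed_segment g h)"
  proof (cases "open_segment p w \<inter> B = {}")
    case True
    have "closed_segment p y \<subseteq> convex hull {p, x, y}"
      by (intro closed_segment_subset) (auto simp: hull_inc)
    hence "open_segment p w \<subseteq> convex hull {p, x, y}"
      using pwy by (auto simp: open_segment_def)
    hence "open_triangle p x y \<union> open_segment p w \<subseteq> I"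
      using True tI open_triangle_nonempty[of p x y] by (intro open_triangle_Un_subset_I[OF ncy tB]) auto
    thus ?thesis by blast
  next
    case False
    then obtain z g h where z: "z \<in> open_segment p w" "side g h" "z \<in> closed_segment g h"
      using mem_B by blast
    have gV: "g \<in> V" "h \<in> V" "g \<noteq> h" using side_ends z by auto
    have zgh: "z \<in> open_segment g h" using z noV' gV by (auto simp: open_segment_def)
    obtain m where m: "0 < m" "m < 1" "z = (1 - m) *\<^sub>R g + m *\<^sub>R h"
      "\<And>p q. orient p q z = (1 - m) * orient p q g + m * orient p q h"
      using zgh by (rule orient_open_segment) auto
    have zpy: "z \<in> open_segment p y" using z pwy by blast
    have cz: "orient p y z = 0" using zpy by (auto elim!: open_segmentE simp: orient_affine)
    \<comment> \<open>An end of the side on the flank of \<open>x\<close> would draw the side into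
      the empty triangle. As \<open>z\<close> is on the line \<open>p y\<close> and strictly between
      the ends, no end can be on the other flank either, so the side runs along this line.\<close>
    have no: "\<not> orient p y e * orient p y x > 0" if "e = g \<or> e = h" for e
    proof
      assume "orient p y e * orient p y x > 0"
      from leaves_edge_into_open_triangle[OF zpy this] obtain f
        where f: "f \<in> open_segment z e" "f \<in> open_triangle p x y" by blast
      have "closed_segment z e \<subseteq> closed_segment g h" using that z(3)
        by (metis ends_in_segment subset_closed_segment)
      hence "f \<in> B" using f side_subset_boundary[OF z(2)] by (auto simp: open_segment_def)
      thus False using f tB by blast
    qed
    have nz: "orient p y x \<noteq> 0" using ncy by (metis orient_rotate orient_swap neg_equal_0_iff_equal)
    have s: "(1 - m) * orient p y g + m * orient p y h = 0" using m(4) cz by simp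
    have gh0: "orient p y g = 0 \<and> orient p y h = 0"
    proof -
      have 1: "(1 - m) * (orient p y g * orient p y x) + m * (orient p y h * orient p y x) = 0"
        using s by (metis (no_types, lifting) distrib_right mult.assoc mult_zero_left)
      have n: "orient p y g * orient p y x \<le> 0" "orient p y h * orient p y x \<le> 0" using no[of g] no[of h] by auto
      have "(1 - m) * (orient p y g * orient p y x) \<le> 0" "m * (orient p y h * orient p y x) \<le> 0"
        using n m by (auto intro!: mult_nonneg_nonpos)
      hence "(1 - m) * (orient p y g * orient p y x) = 0" "m * (orient p y h * orient p y x) = 0" using 1 by linarith+
      thus ?thesis using m nz by simp
    qed
    have lin: "orient p w e = (1 - i) * orient p y e" for e
      unfolding w_eq by (simp add: orient_def algebra_simps)
    have "closed_segment p w \<subseteq> closed_segment g h"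
      by (rule collinear_segment_subset[OF z(1) zgh]) (use gh0 lin gV noV' in auto)
    thus ?thesis using z(2) by blast
  qed
  thus ?thesis using that[OF _ y wy tI noV' _ pw] w(1) by (auto simp: W_def)
qed

section \<open>Apexes over a clean edge\<close>

lemma edge_from_segment:
  assumes "u \<in> V" "w \<in> V" "u \<noteq> w"
    "open_segment u w \<subseteq> I \<or> (\<exists>g h. side g h \<and> closed_segment u w \<subseteq> closed_segment g h)"
  shows "edge u w"
  using assms(4)
proof
  assume "open_segment u w \<subseteq> I" thus ?thesis using assms by (simp add: edge_def)
next
  assume "\<exists>g h. side g h \<and> closed_segment u w \<subseteq> closed_segment g h"
  then obtain g h where gh: "side g h" "closed_segment u w \<subseteq> closed_segment g h" by blast
  hence "u \<in> closed_segment g h" "w \<in> closed_segment g h" by auto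
  hence "u \<in> {g, h}" "w \<in> {g, h}" using side_vertex gh assms by blast+
  hence "side u w" using gh side_sym assms by auto
  thus ?thesis by (rule side_edge)
qed

text \<open>The two alternatives are those that \<open>sweep\<close> requires. The side
  \<open>p q\<close>, if it is one, contains \<open>p x\<close> but is collinear with it and so
  misses the open triangle. Every other side meets neither the inside of the clean edge nor that of
  \<open>x y\<close>.\<close>

lemma side_avoids_wedge:
  assumes edge: "edge p q" and x: "x \<in> open_segment p q" and free: "open_segment x y \<subseteq> I"
    and nc: "orient p x y \<noteq> 0" and side: "side g h"
  shows "closed_segment g h \<inter> (closed_segment p x \<union> closed_segment x y) \<subseteq> {p, y} \<or>
    closed_segment g h \<inter> open_triangle p x y = {}"
proof (cases "{g, h} = {p, q}")
  case True
  hence seg: "closed_segment g h = closed_segment p q"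
    by (auto simp: doubleton_eq_iff closed_segment_commute)
  have xpq: "orient p x z = 0" if z: "z \<in> closed_segment p q" for z
  proof -
    obtain k where k: "x = (1 - k) *\<^sub>R p + k *\<^sub>R q" using x by (auto elim: open_segmentE)
    have "orient p x z = k * orient p q z" unfolding k by (simp add: orient_def algebra_simps)
    thus ?thesis using orient_closed_segment_zero[OF z] by simp
  qed
  have "orient p x z \<noteq> 0" if z: "z \<in> open_triangle p x y" for z
  proof -
    obtain a b c where "0 < c" "a + b + c = 1" "z = a *\<^sub>R p + b *\<^sub>R x + c *\<^sub>R y"
      using z by (rule open_triangleE)
    thus ?thesis using nc by (simp add: orient_bary)
  qed
  thus ?thesis unfolding seg using xpq by blast
next
  case False
  have off: "z \<notin> open_segment p q" if "z \<in> closed_segment g h" for z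
    using edge_side[OF edge _ side that] False by blast
  have "z = p \<or> z = y"
    if z: "z \<in> closed_segment g h" "z \<in> closed_segment p x \<or> z \<in> closed_segment x y" for z
    using z(2)
  proof
    assume zp: "z \<in> closed_segment p x"
    show ?thesis
    proof (rule ccontr)
      assume n: "\<not> ?thesis"
      have "z \<noteq> x" using off[OF z(1)] x by blast
      hence "z \<in> open_segment p x" using zp n by (simp add: open_segment_def)
      moreover have "open_segment p x \<subseteq> open_segment p q"
        using x by (intro open_segment_subset) (auto simp: open_segment_def)
      ultimately show False using off[OF z(1)] by blast
    qed
  next
    assume zx: "z \<in> closed_segment x y"
    have "z \<noteq> x" using off[OF z(1)] x by blast
    moreover have "z \<notin> open_segment x y"
      using free z(1) side_subset_boundary[OF side] B_Int_I by blast
    ultimately show ?thesis using zx by (simp add: open_segment_def)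
  qed
  thus ?thesis by auto
qed

lemma open_triangle_split_subset_I:
  assumes "x \<in> open_segment u v" "x \<noteq> y"
    "open_triangle u x y \<subseteq> I" "open_triangle v x y \<subseteq> I" "open_segment x y \<subseteq> I"
  shows "open_triangle u v y \<subseteq> I"
  using open_triangle_split[OF assms(1,2)] assms(3-5) by blast

text \<open>Sweep about \<open>u\<close> from \<open>x\<close> towards \<open>r\<close>, then about \<open>v\<close> within the part of the triangle cut off by
  the first sweep.\<close>

lemma apex:
  assumes edge: "edge u v" and x: "x \<in> open_segment u v" and r: "r \<in> V" "orient u v r \<noteq> 0"
    and xr: "open_segment x r \<subseteq> I"
  obtains w a b c where "edge u w" "edge v w" "0 \<le> a" "0 \<le> b" "0 < c" "a + b + c = 1"
    "w = a *\<^sub>R u + b *\<^sub>R v + c *\<^sub>R r"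
proof -
  note result = that
  have V: "u \<in> V" "v \<in> V" "u \<noteq> v" using edge by (auto simp: edge_def)
  have x': "x \<in> open_segment v u" using x by (simp add: open_segment_commute)
  obtain k where k: "0 < k" "k < 1" "x = (1 - k) *\<^sub>R u + k *\<^sub>R v"
    using x by (auto elim: open_segmentE)
  have crx: "orient u x z = k * orient u v z" "orient v x z = - (1 - k) * orient u v z" for z
    unfolding k(3) by (simp_all add: orient_def algebra_simps)
  have ncu: "orient u x z \<noteq> 0" and ncv: "orient v x z \<noteq> 0" if "orient u v z \<noteq> 0" for z
    unfolding crx using k that by auto
  have crvx: "orient u v x = 0" unfolding k(3) by (simp add: orient_affine)
  have V_off: "z \<notin> open_segment x r" if "z \<in> V" for z using that xr V_not_I by blast
  have pos1: "\<exists>s>0. orient u v y = s * orient u v r" if "y \<in> open_segment x r \<or> y = r" for y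
    using that
  proof
    assume "y \<in> open_segment x r"
    then obtain s where "0 < s" "orient u v y = (1 - s) * orient u v x + s * orient u v r"
      by (rule orient_open_segment) blast
    thus ?thesis using crvx by auto
  qed (auto intro: exI[of _ 1])
  have hx: "x \<in> convex hull {u, v, r}"
    using k by (intro in_hull3I[of "1 - k" k 0]) auto
  have hy: "y \<in> convex hull {u, v, r}" if "y \<in> open_segment x r \<or> y = r" for y
  proof -
    have "closed_segment x r \<subseteq> convex hull {u, v, r}"
      using hx by (intro closed_segment_subset) (auto simp: hull_inc)
    thus ?thesis using that by (auto simp: open_segment_def hull_inc)
  qed
  \<comment> \<open>A common apex found on a ray from an end of \<open>u v\<close> to a point
    \<open>y\<close> of \<open>x r\<close> always meets the requirements: its weight on
    \<open>r\<close> is positive because \<open>y\<close> is off the line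
    \<open>u v\<close>.\<close>
  have finish: thesis
    if w: "edge u w" "edge v w" and y: "y \<in> open_segment x r \<or> y = r"
      and wy: "w \<in> open_segment p y \<or> w = y" and p: "p = u \<or> p = v" for w y p
  proof -
    obtain s where s: "s > 0" "orient u v y = s * orient u v r" using pos1[OF y] by blast
    have "closed_segment p y \<subseteq> convex hull {u, v, r}"
      using hy[OF y] p by (intro closed_segment_subset) (auto simp: hull_inc)
    hence "w \<in> convex hull {u, v, r}" using wy hy[OF y] by (auto simp: open_segment_def)
    then obtain a b c where abc: "0 \<le> a" "0 \<le> b" "0 \<le> c" "a + b + c = 1"
      "w = a *\<^sub>R u + b *\<^sub>R v + c *\<^sub>R r" unfolding in_hull3 by blast
    have "orient u v w \<noteq> 0"
      using wy
    proof
      assume "w \<in> open_segment p y"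
      then obtain t where "0 < t" "orient u v w = (1 - t) * orient u v p + t * orient u v y"
        by (rule orient_open_segment) blast
      thus ?thesis using p s r by auto
    qed (use s r in auto)
    moreover have "orient u v w = c * orient u v r" unfolding abc(5) by (rule orient_bary[OF abc(4)])
    ultimately have "c > 0" using abc by (cases "c = 0") auto
    thus thesis using result[OF w] abc by blast
  qed
  have nru: "orient u x r \<noteq> 0" by (rule ncu[OF r(2)])
  obtain w1 y1 where 1: "w1 \<in> V" "y1 \<in> open_segment x r \<or> y1 = r" "w1 \<in> open_segment u y1 \<or> w1 = y1"
    "open_triangle u x y1 \<subseteq> I" "open_segment u w1 \<inter> V = {}"
    "open_segment u w1 \<subseteq> I \<or> (\<exists>g h. side g h \<and> closed_segment u w1 \<subseteq> closed_segment g h)"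
    "u \<noteq> w1"
    by (rule sweep[OF nru side_avoids_wedge[OF edge x xr nru] disjI2[OF xr], of r])
      (use r nru in \<open>auto simp: hull_inc\<close>)
  have Eu1: "edge u w1" using edge_from_segment V 1 by blast
  obtain s1 where s1: "s1 > 0" "orient u v y1 = s1 * orient u v r" using pos1[OF 1(2)] by blast
  hence ny1: "orient u v y1 \<noteq> 0" using r by auto
  have nrv: "orient v x y1 \<noteq> 0" by (rule ncv[OF ny1])
  have xy1: "x \<noteq> y1" using nrv by auto
  have "open_segment x y1 \<subseteq> open_segment x r"
    using 1(2) by (intro open_segment_subset) (auto simp: open_segment_def)
  hence xy1I: "open_segment x y1 \<subseteq> I" using xr by blast
  note wedge = side_avoids_wedge[OF edge_sym[OF edge] x' xy1I nrv]
  show thesis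
  \<comment> \<open>The second sweep needs a vertex to stop at. If there is none off the line
    \<open>v x\<close>, the remaining triangle is free of the boundary and \<open>v\<close> sees
    \<open>w1\<close> already.\<close>
  proof (cases "\<exists>v0 \<in> V. v0 \<in> convex hull {v, x, y1} \<and> orient v x v0 \<noteq> 0")
    case True
    then obtain v0 where v0: "v0 \<in> V" "v0 \<in> convex hull {v, x, y1}" "orient v x v0 \<noteq> 0" by blast
    obtain w2 y2 where 2: "w2 \<in> V" "y2 \<in> open_segment x y1 \<or> y2 = y1"
      "w2 \<in> open_segment v y2 \<or> w2 = y2"
      "open_triangle v x y2 \<subseteq> I" "open_segment v w2 \<inter> V = {}"
      "open_segment v w2 \<subseteq> I \<or> (\<exists>g h. side g h \<and> closed_segment v w2 \<subseteq> closed_segment g h)"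
      "v \<noteq> w2"
      by (rule sweep[OF nrv wedge disjI2[OF xy1I] v0])
    have Ev2: "edge v w2" using edge_from_segment V 2 by blast
    have y2: "y2 \<in> open_segment x r \<or> y2 = r"
      using 2(2) 1(2) \<open>open_segment x y1 \<subseteq> open_segment x r\<close> by blast
    obtain s2 where s2: "s2 > 0" "orient u v y2 = s2 * orient u v r" using pos1[OF y2] by blast
    hence "orient u v y2 \<noteq> 0" using r by auto
    hence xy2: "x \<noteq> y2" using crvx by auto
    have t2: "open_triangle u v y2 \<subseteq> I"
    proof (rule open_triangle_split_subset_I[OF x xy2 _ 2(4)])
      show "open_triangle u x y2 \<subseteq> I" using 1(4) 2(2) open_triangle_mono by blast
      have "open_segment x y2 \<subseteq> open_segment x y1"
        using 2(2) by (intro open_segment_subset) (auto simp: open_segment_def)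
      thus "open_segment x y2 \<subseteq> I" using xy1I by blast
    qed
    show thesis
    proof (cases "w2 = y2")
      case False
      hence w2: "w2 \<in> open_segment v y2" using 2 by blast
      hence "open_segment u w2 \<subseteq> I" using open_segment_subset_open_triangle t2 by blast
      moreover have "u \<noteq> w2"
      proof
        assume "u = w2"
        moreover obtain t where "0 < t" "orient u v w2 = (1 - t) * orient u v v + t * orient u v y2"
          using w2 by (rule orient_open_segment) blast
        ultimately show False using \<open>orient u v y2 \<noteq> 0\<close> by simp
      qed
      ultimately have "edge u w2" using V 2 by (simp add: edge_def)
      thus thesis using finish[OF _ Ev2 y2 2(3)] by blast
    next
      case True
      \<comment> \<open>A vertex on \<open>x r\<close> away from \<open>x\<close> can only be
        \<open>r\<close>, since the open segment is interior. Both sweeps then end on rays to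
        \<open>r\<close>, and \<open>w1\<close> either is \<open>r\<close> or lies inside
        \<open>u r\<close>, where \<open>v\<close> sees it through the empty triangle.\<close>
      have y2r: "y2 = r" using True V_off[OF 2(1)] y2 by simp
      hence y1r: "y1 = r" using 2(1,2) True V_off \<open>open_segment x y1 \<subseteq> open_segment x r\<close> 1(2) by auto
      show thesis
      proof (cases "w1 = r")
        case True
        thus thesis using finish[of r r u] Eu1 Ev2 y2r \<open>w2 = y2\<close> by auto
      next
        case False
        hence "w1 \<in> open_segment u r" using 1(3) y1r by blast
        hence "open_segment v w1 \<subseteq> open_triangle v u r" by (rule open_segment_subset_open_triangle)
        hence "open_segment v w1 \<subseteq> I" using t2 y2r open_triangle_swap by blast
        moreover have "v \<noteq> w1"
        proof
          assume "v = w1"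
          moreover obtain t where "0 < t" "orient u v w1 = (1 - t) * orient u v u + t * orient u v r"
            using \<open>w1 \<in> open_segment u r\<close> by (rule orient_open_segment) blast
          ultimately show False using r by simp
        qed
        ultimately have "edge v w1" using V 1 by (simp add: edge_def)
        thus thesis using finish[OF Eu1 _ 1(2,3)] by blast
      qed
    qed
  next
    case False
    have noV: "z \<notin> open_triangle v x y1" if z: "z \<in> V" for z
    proof
      assume t: "z \<in> open_triangle v x y1"
      then obtain a b c where "0 < c" "a + b + c = 1" "z = a *\<^sub>R v + b *\<^sub>R x + c *\<^sub>R y1"
        by (rule open_triangleE)
      hence "orient v x z \<noteq> 0" using nrv by (simp add: orient_bary)
      thus False using False t z open_triangle_subset_hull by blast
    qed
    have "closed_segment g h \<inter> open_triangle v x y1 = {}" if "side g h" for g h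
      using wedge[OF that]
    proof
      assume m: "closed_segment g h \<inter> (closed_segment v x \<union> closed_segment x y1) \<subseteq> {v, y1}"
      show ?thesis using noV side_ends[OF that] by (intro segment_avoids_open_triangle[OF nrv _ _ m]) auto
    qed
    hence tB: "open_triangle v x y1 \<inter> B = {}" using mem_B by blast
    have "closed_segment x y1 \<subseteq> convex hull {v, x, y1}"
      by (intro closed_segment_subset) (auto simp: hull_inc)
    hence "open_segment x y1 \<subseteq> convex hull {v, x, y1}" by (auto simp: open_segment_def)
    moreover have "open_segment x y1 \<inter> B = {}" using xy1I B_Int_I by blast
    moreover have "open_segment x y1 \<inter> I \<noteq> {}" using xy1I xy1 by (simp add: inf.absorb1)
    ultimately have "open_triangle v x y1 \<union> open_segment x y1 \<subseteq> I"
      by (intro open_triangle_Un_subset_I[OF nrv tB]) auto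
    hence t1: "open_triangle u v y1 \<subseteq> I"
      using open_triangle_split_subset_I[OF x xy1 1(4) _ xy1I] by blast
    have "w1 \<noteq> y1"
    proof
      assume "w1 = y1"
      hence "y1 \<in> V" using 1 by simp
      thus False using False nrv by (auto simp: hull_inc)
    qed
    hence w1: "w1 \<in> open_segment u y1" using 1 by blast
    hence "open_segment v w1 \<subseteq> open_triangle v u y1" by (rule open_segment_subset_open_triangle)
    hence "open_segment v w1 \<subseteq> I" using t1 open_triangle_swap by blast
    moreover have "v \<noteq> w1"
    proof
      assume "v = w1"
      moreover obtain t where "0 < t" "orient u v w1 = (1 - t) * orient u v u + t * orient u v y1"
        using w1 by (rule orient_open_segment) blast
      ultimately show False using ny1 by simp
    qed
    ultimately have "edge v w1" using V 1 by (simp add: edge_def)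
    thus thesis using finish[OF Eu1 _ 1(2,3)] by blast
  qed
qed

text \<open>Only the sign of \<open>s\<close> matters: positive stands for the left flank of
  \<open>u v\<close>, negative for the right one. The interior is required near a single point of
  the edge, which suits sides and interior chords alike.\<close>

definition free_side :: "real \<Rightarrow> complex \<Rightarrow> complex \<Rightarrow> bool" where
  "free_side s u v \<longleftrightarrow>
    (\<exists>x \<in> open_segment u v. \<exists>z. s * orient u v z > 0 \<and> open_segment x z \<subseteq> I)"

text \<open>The segment \<open>x z\<close> is prolonged until it hits the boundary at
  \<open>z1\<close>. If this is not a vertex, the side through \<open>z1\<close> has an end
  \<open>e\<close> on the right flank, and a ray rotating about \<open>x\<close> from
  \<open>z1\<close> towards \<open>e\<close> meets a first vertex.\<close>

lemma vertex_on_free_side: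
  assumes edge: "edge u v" and fs: "free_side s u v"
  obtains x r where "x \<in> open_segment u v" "r \<in> V" "s * orient u v r > 0" "open_segment x r \<subseteq> I"
proof -
  note result = that
  obtain x z where x: "x \<in> open_segment u v" and z: "s * orient u v z > 0" "open_segment x z \<subseteq> I"
    using fs unfolding free_side_def by blast
  have crx: "orient u v x = 0" using x by (auto elim!: open_segmentE simp: orient_affine)
  have xz: "x \<noteq> z" using z crx by auto
  define l where "l = z - x"
  have l: "l \<noteq> 0" using xz by (simp add: l_def)
  have ray: "x + q *\<^sub>R l = (1 - q) *\<^sub>R x + q *\<^sub>R z" for q
    by (simp add: l_def algebra_simps)
  \<comment> \<open>The prolongation starts at the midpoint of \<open>x z\<close> because
    \<open>x\<close> itself is a boundary point when \<open>u v\<close> is a side.\<close>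
  have "x + (1/2) *\<^sub>R l \<in> open_segment x z"
    using xz by (intro open_segmentI[OF _ _ ray]) auto
  hence m: "x + (1/2) *\<^sub>R l \<in> interior I" using z open_I by (auto simp: interior_open)
  obtain d where d: "0 < d" "(x + (1/2) *\<^sub>R l) + d *\<^sub>R l \<in> frontier I"
    "\<And>e. 0 \<le> e \<Longrightarrow> e < d \<Longrightarrow> (x + (1/2) *\<^sub>R l) + e *\<^sub>R l \<in> interior I"
    using ray_to_frontier[OF bounded_I m l] by blast
  define D where "D = 1/2 + d"
  have D: "D > 1/2" using d by (simp add: D_def)
  define z1 where "z1 = x + D *\<^sub>R l"
  have z1B: "z1 \<in> B" using d(2) frontier_I by (simp add: z1_def D_def algebra_simps)
  have z1_alt: "z1 = (1 - D) *\<^sub>R x + D *\<^sub>R z" by (simp add: z1_def l_def algebra_simps)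
  have inI: "x + q *\<^sub>R l \<in> I" if q: "0 < q" "q < D" for q
  proof (cases "q < 1/2")
    case True
    hence "x + q *\<^sub>R l \<in> open_segment x z"
      using xz q by (intro open_segmentI[OF _ _ ray]) auto
    thus ?thesis using z by blast
  next
    case False
    have "(x + (1/2) *\<^sub>R l) + (q - 1/2) *\<^sub>R l \<in> interior I"
      using False q by (intro d(3)) (auto simp: D_def)
    thus ?thesis using open_I by (simp add: interior_open algebra_simps)
  qed
  have xz1: "open_segment x z1 \<subseteq> I"
  proof
    fix y assume "y \<in> open_segment x z1"
    then obtain q where q: "0 < q" "q < 1" "y = (1 - q) *\<^sub>R x + q *\<^sub>R z1" by (rule open_segmentE)
    hence "y = x + (q * D) *\<^sub>R l" by (simp add: z1_def algebra_simps)
    moreover have "0 < q * D" "q * D < D" using q D by auto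
    ultimately show "y \<in> I" using inI by blast
  qed
  have "orient u v z1 = D * orient u v z" unfolding z1_alt using crx by (simp add: orient_affine)
  hence z1pos: "s * orient u v z1 > 0" using z(1) D by (simp add: mult.left_commute)
  hence nxz1: "x \<noteq> z1" using crx by auto
  show thesis
  proof (cases "z1 \<in> V")
    case True
    thus thesis using result[OF x _ z1pos xz1] by blast
  next
    case False
    obtain g h where gh: "side g h" "z1 \<in> closed_segment g h" using z1B mem_B by blast
    hence gV: "g \<in> V" "h \<in> V" "g \<noteq> h" using side_ends by auto
    have "z1 \<in> open_segment g h" using gh gV False by (auto simp: open_segment_def)
    moreover then obtain m where m: "0 < m" "m < 1"
      "orient u v z1 = (1 - m) * orient u v g + m * orient u v h" by (rule orient_open_segment) blast
    have "s * orient u v g > 0 \<or> s * orient u v h > 0"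
    proof (rule ccontr)
      assume "\<not> ?thesis"
      hence "(1 - m) * (s * orient u v g) \<le> 0" "m * (s * orient u v h) \<le> 0"
        using m by (auto intro!: mult_nonneg_nonpos simp: not_less)
      moreover have "s * orient u v z1 = (1 - m) * (s * orient u v g) + m * (s * orient u v h)"
        by (simp add: m(3) algebra_simps)
      ultimately show False using z1pos by linarith
    qed
    ultimately obtain e f where ef: "side e f" "z1 \<in> open_segment e f" "s * orient u v e > 0"
      using gh side_sym by (metis open_segment_commute)
    have eV: "e \<in> V" "f \<in> V" "e \<noteq> f" using side_ends ef by auto
    have efB: "closed_segment e f \<subseteq> B" using ef side_subset_boundary by blast
    \<comment> \<open>A boundary segment on the line \<open>x z1\<close> ending at \<open>z1\<close>
      cannot begin before \<open>z1\<close>, as the points just before \<open>z1\<close> are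
      interior. The parameter \<open>q\<close> is chosen in the unit interval and beyond
      \<open>k\<close>, so it gives a point on both segments.\<close>
    have behind: "1 \<le> k" if c: "c = (1 - k) *\<^sub>R x + k *\<^sub>R z1" "closed_segment c z1 \<subseteq> B" for c k
    proof (rule ccontr)
      assume k: "\<not> 1 \<le> k"
      define q where "q = max (1/2) ((k + 1) / 2)"
      have q: "0 < q" "q < 1" "k < q" using k by (auto simp: q_def max_def)
      define t where "t = (q - k) / (1 - k)"
      have t: "0 \<le> t" "t \<le> 1" using q k by (auto simp: t_def divide_le_eq)
      have tq: "q = (1 - t) * k + t"
      proof -
        have "t * (1 - k) = q - k" using k by (simp add: t_def)
        thus ?thesis by (simp add: algebra_simps)
      qed
      have "(1 - q) *\<^sub>R x + q *\<^sub>R z1 = (1 - t) *\<^sub>R c + t *\<^sub>R z1"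
        unfolding c(1) tq by (simp add: algebra_simps)
      hence "(1 - q) *\<^sub>R x + q *\<^sub>R z1 \<in> closed_segment c z1" using t by (auto simp: in_segment)
      moreover have "(1 - q) *\<^sub>R x + q *\<^sub>R z1 \<in> open_segment x z1"
        using q nxz1 by (auto simp: in_segment)
      ultimately show False using c(2) xz1 B_Int_I by blast
    qed
    \<comment> \<open>If \<open>e\<close> were on the line \<open>x z1\<close>, so would be
      \<open>f\<close>, and both would lie at or beyond \<open>z1\<close>, which is strictly between
      them.\<close>
    have nc: "orient x z1 e \<noteq> 0"
    proof
      assume e0: "orient x z1 e = 0"
      obtain n where n: "0 < n" "n < 1" "z1 = (1 - n) *\<^sub>R e + n *\<^sub>R f"
        using ef(2) by (auto elim: open_segmentE)
      have "orient x z1 z1 = (1 - n) * orient x z1 e + n * orient x z1 f"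
        using n by (metis orient_affine diff_add_cancel)
      hence f0: "orient x z1 f = 0" using e0 n by simp
      obtain i where i: "e = (1 - i) *\<^sub>R x + i *\<^sub>R z1" using orient_zero_line[OF e0 nxz1] by blast
      obtain j where j: "f = (1 - j) *\<^sub>R x + j *\<^sub>R z1" using orient_zero_line[OF f0 nxz1] by blast
      have "closed_segment e z1 \<subseteq> B" "closed_segment f z1 \<subseteq> B"
        using efB ef(2) by (meson ends_in_segment open_closed_segment subset_closed_segment subset_trans)+
      hence ij: "1 \<le> i" "1 \<le> j" using behind i j by blast+
      have "((1 - n) * (i - 1) + n * (j - 1)) *\<^sub>R (z1 - x) = ((1 - n) *\<^sub>R e + n *\<^sub>R f) - z1"
        unfolding i j by (simp add: algebra_simps)
      hence "((1 - n) * (i - 1) + n * (j - 1)) *\<^sub>R (z1 - x) = 0" using n(3) by simp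
      hence "(1 - n) * (i - 1) + n * (j - 1) = 0" using nxz1 by simp
      moreover have "0 \<le> (1 - n) * (i - 1)" "0 \<le> n * (j - 1)" using n ij by auto
      ultimately have "(1 - n) * (i - 1) = 0" "n * (j - 1) = 0" by linarith+
      hence "i = 1" "j = 1" using n by auto
      thus False using i j eV by simp
    qed
    \<comment> \<open>The swept edge \<open>z1 e\<close> is part of the side \<open>e f\<close>,
      which misses the open triangle; any other side can meet the two swept edges at most in
      \<open>x\<close> or \<open>e\<close>.\<close>
    have sides: "closed_segment g' h' \<inter> (closed_segment x z1 \<union> closed_segment z1 e) \<subseteq> {x, e} \<or>
      closed_segment g' h' \<inter> open_triangle x z1 e = {}" if side_gh: "side g' h'" for g' h'
    proof (cases "{g', h'} = {e, f}")
      case True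
      hence seg: "closed_segment g' h' = closed_segment e f"
        by (auto simp: doubleton_eq_iff closed_segment_commute)
      have "orient z1 e y = 0" if y: "y \<in> closed_segment e f" for y
      proof -
        obtain n where n: "z1 = (1 - n) *\<^sub>R e + n *\<^sub>R f"
          using ef(2) by (auto elim: open_segmentE)
        have "orient z1 e y = n * - orient e f y" unfolding n by (simp add: orient_def algebra_simps)
        thus ?thesis using orient_closed_segment_zero[OF y] by simp
      qed
      moreover have "orient z1 e y \<noteq> 0" if y: "y \<in> open_triangle x z1 e" for y
      proof -
        obtain a b c where "0 < c" "a + b + c = 1" "y = a *\<^sub>R z1 + b *\<^sub>R e + c *\<^sub>R x"
          using y unfolding open_triangle_rotate[of x] by (rule open_triangleE)
        thus ?thesis using nc orient_rotate[of x z1 e] by (simp add: orient_bary)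
      qed
      ultimately show ?thesis unfolding seg by blast
    next
      case False
      have meet: "q \<in> V" if "q \<in> closed_segment g' h'" "q \<in> closed_segment e f" for q
        using side_inter[OF side_gh ef(1)] that False by blast
      have "q = x \<or> q = e"
        if q: "q \<in> closed_segment g' h'" "q \<in> closed_segment x z1 \<or> q \<in> closed_segment z1 e" for q
        using q(2)
      proof
        assume qx: "q \<in> closed_segment x z1"
        have "q \<notin> open_segment x z1" using xz1 side_subset_boundary[OF side_gh] q(1) B_Int_I by blast
        moreover have "q \<noteq> z1"
          using meet[OF q(1)] \<open>z1 \<notin> V\<close> ef(2) by (auto simp: open_segment_def)
        ultimately show ?thesis using qx by (auto simp: open_segment_def)
      next
        assume qe: "q \<in> closed_segment z1 e"
        have "closed_segment z1 e \<subseteq> closed_segment e f"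
          using ef(2) by (auto simp: subset_closed_segment open_segment_def)
        hence qef: "q \<in> closed_segment e f" using qe by blast
        hence "q = e \<or> q = f" using side_vertex[OF ef(1) meet[OF q(1)]] by blast
        moreover have "f \<notin> closed_segment z1 e"
        proof
          assume "f \<in> closed_segment z1 e"
          moreover have "between (e, f) z1" using ef(2) by (auto simp: between_mem_segment open_segment_def)
          ultimately have "f = z1"
            by (metis between_antisym between_commute between_mem_segment)
          thus False using ef(2) by (simp add: open_segment_def)
        qed
        ultimately show ?thesis using qe by blast
      qed
      thus ?thesis by auto
    qed
    obtain w y where w: "w \<in> V" "y \<in> open_segment z1 e \<or> y = e" "w \<in> open_segment x y \<or> w = y"
      "open_triangle x z1 y \<subseteq> I" "open_segment x w \<inter> V = {}"
      "open_segment x w \<subseteq> I \<or> (\<exists>g h. side g h \<and> closed_segment x w \<subseteq> closed_segment g h)" "x \<noteq> w"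
      by (rule sweep[OF nc sides disjI1[OF xz1], of e]) (use eV nc in \<open>auto simp: hull_inc\<close>)
    have ypos: "s * orient u v y > 0"
      using w(2)
    proof
      assume "y \<in> open_segment z1 e"
      then obtain t where t: "0 < t" "t < 1" "orient u v y = (1 - t) * orient u v z1 + t * orient u v e"
        by (rule orient_open_segment) blast
      have "s * orient u v y = (1 - t) * (s * orient u v z1) + t * (s * orient u v e)"
        by (simp add: t(3) algebra_simps)
      moreover have "0 < (1 - t) * (s * orient u v z1)" "0 < t * (s * orient u v e)"
        using t z1pos ef(3) by (auto intro: mult_pos_pos)
      ultimately show ?thesis by linarith
    qed (use ef in auto)
    have wpos: "s * orient u v w > 0"
      using w(3)
    proof
      assume "w \<in> open_segment x y"
      then obtain t where t: "0 < t" "orient u v w = (1 - t) * orient u v x + t * orient u v y"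
        by (rule orient_open_segment) blast
      have "s * orient u v w = t * (s * orient u v y)" by (simp add: t crx)
      thus ?thesis using mult_pos_pos[OF t(1) ypos] by linarith
    qed (use ypos in auto)
    \<comment> \<open>In the other outcome of the sweep a side would contain \<open>x\<close>, hence
      be \<open>u v\<close>, and \<open>w\<close> would lie on the line \<open>u v\<close>.\<close>
    have "open_segment x w \<subseteq> I"
      using w(6)
    proof
      assume "\<exists>g h. side g h \<and> closed_segment x w \<subseteq> closed_segment g h"
      then obtain g' h' where g': "side g' h'" "closed_segment x w \<subseteq> closed_segment g' h'" by blast
      hence "{g', h'} = {u, v}" using edge_side[OF edge x g'(1)] by auto
      hence "closed_segment g' h' = closed_segment u v"
        by (auto simp: doubleton_eq_iff closed_segment_commute)
      moreover have "w \<in> closed_segment g' h'" using g'(2) by auto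
      ultimately have "orient u v w = 0" by (metis orient_closed_segment_zero)
      thus ?thesis using wpos by simp
    qed
    thus thesis using result[OF x w(1) wpos] by blast
  qed
qed

lemma apex_on_free_side:
  assumes edge: "edge u v" and fs: "free_side s u v"
  obtains w where "edge u w" "edge v w" "s * orient u v w > 0"
proof -
  obtain x r where x: "x \<in> open_segment u v" "r \<in> V" "s * orient u v r > 0" "open_segment x r \<subseteq> I"
    using vertex_on_free_side[OF assms] by blast
  hence "orient u v r \<noteq> 0" by auto
  then obtain w a b c where w: "edge u w" "edge v w" "0 < c" "a + b + c = 1"
    "w = a *\<^sub>R u + b *\<^sub>R v + c *\<^sub>R r" using apex[OF edge x(1,2) _ x(4)] by metis
  have "orient u v w = c * orient u v r" unfolding w(5) by (rule orient_bary[OF w(4)])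
  hence "s * orient u v w = c * (s * orient u v r)" by simp
  hence "s * orient u v w > 0" using mult_pos_pos[OF w(3) x(3)] by linarith
  thus thesis using that w by blast
qed

text \<open>The vertex of the segment nearest to \<open>x\<close> is taken. A side met before it
  cannot be crossed, since the region lies on one side of it only, and cannot run along the segment,
  since it would then contain the interior point \<open>x\<close>.\<close>

lemma first_vertex:
  assumes x: "x \<in> I" and a: "a \<in> V" "closed_segment x a \<subseteq> R"
  obtains r where "r \<in> V" "r \<in> closed_segment x a" "open_segment x r \<subseteq> I"
proof -
  note result = that
  let ?W = "V \<inter> closed_segment x a"
  have W: "finite ?W" "?W \<noteq> {}" using a by auto
  define r where "r = arg_min_on (dist x) ?W"
  have r: "r \<in> ?W" unfolding r_def by (rule arg_min_if_finite(1)[OF W])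
  have least: "\<not> dist x w < dist x r" if "w \<in> ?W" for w
    using arg_min_if_finite(2)[OF W, of "dist x"] that unfolding r_def by blast
  have xr: "x \<noteq> r" using r x V_not_I by auto
  have sub: "closed_segment x r \<subseteq> closed_segment x a" using r by (simp add: subset_closed_segment)
  have noV: "z \<notin> V" if "z \<in> open_segment x r" for z
  proof
    assume "z \<in> V"
    moreover have "z \<in> closed_segment x a" using that sub by (auto simp: open_segment_def)
    ultimately have "\<not> dist x z < dist x r" using least by blast
    thus False using dist_in_open_segment[OF that] by (simp add: dist_commute)
  qed
  have "open_segment x r \<inter> B = {}"
  proof (rule ccontr)
    assume "open_segment x r \<inter> B \<noteq> {}"
    then obtain z g h where z: "z \<in> open_segment x r" "side g h" "z \<in> closed_segment g h"
      using mem_B by blast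
    have gV: "g \<in> V" "h \<in> V" "g \<noteq> h" using side_ends z by auto
    have zgh: "z \<in> open_segment g h" using z noV gV by (auto simp: open_segment_def)
    obtain m where m: "0 < m" "m < 1" "z = (1 - m) *\<^sub>R g + m *\<^sub>R h"
      "\<And>p q. orient p q z = (1 - m) * orient p q g + m * orient p q h"
      using zgh by (rule orient_open_segment) auto
    obtain k where k: "0 < k" "k < 1" "z = (1 - k) *\<^sub>R x + k *\<^sub>R r"
      "\<And>p q. orient p q z = (1 - k) * orient p q x + k * orient p q r"
      using z(1) by (rule orient_open_segment) auto
    show False
    proof (cases "orient x r g = 0")
      case True
      hence "orient x r h = 0" using m(4)[of x r] k(4)[of x r] m by simp
      hence "closed_segment x r \<subseteq> closed_segment g h"
        using True gV noV by (intro collinear_segment_subset[OF z(1) zgh]) auto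
      hence "x \<in> B" using side_subset_boundary[OF z(2)] by auto
      thus False using x B_Int_I by blast
    next
      case False
      \<comment> \<open>\<open>N\<close> is the change of \<open>orient g h\<close> along
        \<open>x r\<close>. When it is nonzero, the segment passes at \<open>z\<close> from one
        flank of the side to the other.\<close>
      define N where "N = orient g h r - orient g h x"
      have z0: "orient g h z = 0" unfolding m(3) by (simp add: orient_affine)
      have N: "N \<noteq> 0"
      proof
        assume "N = 0"
        hence eq: "orient g h r = orient g h x" by (simp add: N_def)
        hence "orient g h x = 0" using k(4)[of g h] z0 by (simp add: algebra_simps)
        then obtain i where i: "x = (1 - i) *\<^sub>R g + i *\<^sub>R h" using orient_zero_line gV by metis
        obtain j where j: "r = (1 - j) *\<^sub>R g + j *\<^sub>R h"
          using orient_zero_line gV eq \<open>orient g h x = 0\<close> by metis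
        have "orient x r g = 0" unfolding i j by (simp add: orient_def algebra_simps)
        thus False using False by simp
      qed
      have near: "\<exists>y \<in> R. dist z y < e \<and> s * orient g h y > 0" if e: "e > 0" and s: "s * N \<noteq> 0" for e s
      proof -
        define L where "L = dist x r"
        have L: "L > 0" using xr by (simp add: L_def)
        \<comment> \<open>A shift of the parameter by \<open>d\<close> either way stays in the
          segment and moves the point by at most \<open>e / 2\<close>.\<close>
        define d where "d = min (min k (1 - k)) (e / L / 2)"
        have d: "0 < d" "d \<le> k" "d \<le> 1 - k" "d \<le> e / L / 2" using k L e by (auto simp: d_def)
        define t where "t = (if s * N > 0 then d else - d)"
        let ?y = "(1 - (k + t)) *\<^sub>R x + (k + t) *\<^sub>R r"
        have t: "0 \<le> k + t" "k + t \<le> 1" "\<bar>t\<bar> = d" using d k by (auto simp: t_def)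
        have "?y \<in> closed_segment x r" using t by (auto simp: in_segment)
        hence "?y \<in> R" using sub a by blast
        moreover have "dist z ?y < e"
        proof -
          have "z - ?y = t *\<^sub>R (x - r)" unfolding k(3) by (simp add: algebra_simps)
          hence "dist z ?y = d * L" using t by (simp add: dist_norm L_def)
          also have "\<dots> \<le> e / L / 2 * L" using d L by (intro mult_right_mono) auto
          also have "\<dots> < e" using L e by simp
          finally show ?thesis .
        qed
        moreover have "s * orient g h ?y > 0"
        proof -
          have "orient g h ?y = (1 - (k + t)) * orient g h x + (k + t) * orient g h r"
            by (rule orient_affine) simp
          hence "orient g h ?y = ((1 - k) * orient g h x + k * orient g h r) + t * N"
            by (simp add: N_def algebra_simps)
          hence *: "s * orient g h ?y = t * (s * N)" using k(4)[of g h] z0 by (simp add: mult_ac)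
          show ?thesis
          proof (cases "s * N > 0")
            case True
            thus ?thesis unfolding * using d mult_pos_pos[of d "s * N"] by (simp add: t_def)
          next
            case False
            hence "s * N < 0" using s by linarith
            thus ?thesis unfolding * using d mult_neg_neg[of "- d" "s * N"] by (simp add: t_def)
          qed
        qed
        ultimately show ?thesis by blast
      qed
      show False
        by (rule not_R_on_both_sides[OF z(2) zgh])
          (use near[of _ 1] near[of _ "-1"] N in auto)
    qed
  qed
  hence noB: "z \<notin> B" if "z \<in> open_segment x r" for z using that by blast
  have "closed_segment x r - {r} \<subseteq> I"
  proof (rule connected_subset_I)
    have "open_segment x r \<subseteq> closed_segment x r - {r}" by (auto simp: open_segment_def)
    moreover have "closed_segment x r - {r} \<subseteq> closure (open_segment x r)"
      using xr by (simp add: closure_open_segment Diff_subset)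
    ultimately show "connected (closed_segment x r - {r})"
      by (rule connected_intermediate_closure[OF convex_connected[OF convex_open_segment]])
    have "z \<notin> B" if "z \<in> closed_segment x r - {r}" for z
    proof (cases "z = x")
      case True thus ?thesis using x B_Int_I by blast
    next
      case False thus ?thesis using that noB by (simp add: open_segment_def)
    qed
    thus "(closed_segment x r - {r}) \<inter> B = {}" by blast
    show "(closed_segment x r - {r}) \<inter> I \<noteq> {}" using x xr by auto
  qed
  hence "open_segment x r \<subseteq> I" by (auto simp: open_segment_def)
  thus thesis using result r by blast
qed

section \<open>Four-cliques around an interior chord\<close>

lemma open_subset_not_side:
  assumes "open_segment u v \<subseteq> I" "u \<noteq> v" shows "\<not> side u v"
proof
  assume "side u v"
  hence "closed_segment u v \<subseteq> B" by (rule side_subset_boundary)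
  moreover have "midpoint u v \<in> open_segment u v" using assms by simp
  ultimately have "midpoint u v \<in> B" "midpoint u v \<in> I"
    using assms by (auto simp: open_segment_def)
  thus False using B_Int_I by blast
qed

text \<open>The line of sight to \<open>a\<close> may touch the boundary, so the first vertex
  \<open>r\<close> on it takes its place. As \<open>r\<close> is between \<open>x\<close> and
  \<open>a\<close>, and \<open>x\<close> between \<open>u\<close> and \<open>v\<close>, an apex in
  the triangle \<open>u v r\<close> is also in \<open>u v a\<close>. The explicit weights later
  locate a crossing point.\<close>

lemma apex_towards:
  assumes edge: "edge u v" and x: "x \<in> open_segment u v" "x \<in> I" and a: "a \<in> V" "closed_segment x a \<subseteq> R"
    and nc: "orient u v a \<noteq> 0"
  obtains w A B' C where "edge u w" "edge v w" "0 \<le> A" "0 \<le> B'" "0 < C" "A + B' + C = 1"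
    "w = A *\<^sub>R u + B' *\<^sub>R v + C *\<^sub>R a"
proof -
  note result = that
  obtain r where r: "r \<in> V" "r \<in> closed_segment x a" "open_segment x r \<subseteq> I"
    using first_vertex[OF x(2) a] by blast
  obtain q where q: "0 \<le> q" "q \<le> 1" "r = (1 - q) *\<^sub>R x + q *\<^sub>R a"
    using r(2) by (rule closed_segmentE)
  have "r \<noteq> x" using r x V_not_I by blast
  hence q0: "q > 0" using q by (cases "q = 0") auto
  obtain k where k: "0 < k" "k < 1" "x = (1 - k) *\<^sub>R u + k *\<^sub>R v"
    using x(1) by (auto elim: open_segmentE)
  have "orient u v r = (1 - q) * orient u v x + q * orient u v a" unfolding q(3) by (simp add: orient_affine)
  moreover have "orient u v x = 0" unfolding k(3) by (simp add: orient_affine)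
  ultimately have "orient u v r \<noteq> 0" using q0 nc by simp
  then obtain w \<alpha> \<beta> \<gamma> where w: "edge u w" "edge v w" "0 \<le> \<alpha>" "0 \<le> \<beta>" "0 < \<gamma>" "\<alpha> + \<beta> + \<gamma> = 1"
    "w = \<alpha> *\<^sub>R u + \<beta> *\<^sub>R v + \<gamma> *\<^sub>R r" using apex[OF edge x(1) r(1) _ r(3)] by metis
  show thesis
  proof (rule result[OF w(1,2)])
    show "0 \<le> \<alpha> + \<gamma> * (1 - q) * (1 - k)" "0 \<le> \<beta> + \<gamma> * (1 - q) * k" "0 < \<gamma> * q"
      using w q k q0 by simp_all
    have "\<alpha> + \<gamma> * (1 - q) * (1 - k) + (\<beta> + \<gamma> * (1 - q) * k) + \<gamma> * q = \<alpha> + \<beta> + \<gamma>"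
      by (simp add: algebra_simps)
    thus "\<alpha> + \<gamma> * (1 - q) * (1 - k) + (\<beta> + \<gamma> * (1 - q) * k) + \<gamma> * q = 1" using w by simp
    show "w = (\<alpha> + \<gamma> * (1 - q) * (1 - k)) *\<^sub>R u + (\<beta> + \<gamma> * (1 - q) * k) *\<^sub>R v + (\<gamma> * q) *\<^sub>R a"
      unfolding w(7) q(3) k(3) by (simp add: algebra_simps)
  qed
qed

text \<open>Each end of the crossing chord is replaced by an apex in the triangle which that end
  spans with \<open>u v\<close>. The new segment still meets \<open>u v\<close> strictly inside, so
  it runs through two triangles that are interior.\<close>

lemma crossing_clique:
  assumes red: "reduced_polygon P" and uv: "u \<in> V" "v \<in> V" "u \<noteq> v" "open_segment u v \<subseteq> I"
  obtains a b where "edge u a" "edge v a" "edge u b" "edge v b" "edge a b" "orient u v a > 0" "orient u v b < 0"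
proof -
  note result = that
  have edge: "edge u v" using uv by (simp add: edge_def)
  have "chord P u v"
    using edge_vis_adj[OF edge] open_subset_not_side[OF uv(4,3)] by (simp add: chord_def side_def)
  then obtain a0 b0 where ab0: "chord P a0 b0" "crosses u v a0 b0"
    using red unfolding reduced_polygon_def by blast
  obtain x where x: "open_segment u v \<inter> open_segment a0 b0 = {x}"
    using ab0(2) unfolding crosses_def by blast
  have xuv: "x \<in> open_segment u v" and xab0: "x \<in> open_segment a0 b0" using x by auto
  have xI: "x \<in> I" using xuv uv by blast
  have ab0V: "a0 \<in> V" "b0 \<in> V" and ab0R: "closed_segment a0 b0 \<subseteq> R"
    using ab0(1) unfolding chord_def vis_adj_def visible_def by auto
  obtain k where k: "0 < k" "k < 1" "x = (1 - k) *\<^sub>R u + k *\<^sub>R v"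
    using xuv by (auto elim: open_segmentE)
  have crx: "orient u v x = 0" unfolding k(3) by (simp add: orient_affine)
  obtain m0 where m0: "0 < m0" "m0 < 1" "x = (1 - m0) *\<^sub>R a0 + m0 *\<^sub>R b0"
    "orient u v x = (1 - m0) * orient u v a0 + m0 * orient u v b0"
    using xab0 by (rule orient_open_segment) blast
  \<comment> \<open>If both chords were on one line, their open segments would share further points
    near \<open>x\<close>, contrary to the uniqueness in \<open>crosses\<close>.\<close>
  have nz: "orient u v a0 \<noteq> 0"
  proof
    assume a0: "orient u v a0 = 0"
    hence b0: "orient u v b0 = 0" using m0 crx by simp
    let ?l = "\<lambda>t. (1 - t) *\<^sub>R u + t *\<^sub>R v"
    obtain i where i: "a0 = ?l i" using orient_zero_line[OF a0 uv(3)] by blast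
    obtain j where j: "b0 = ?l j" using orient_zero_line[OF b0 uv(3)] by blast
    have inj: "s = t" if "?l s = ?l t" for s t
    proof -
      have "(s - t) *\<^sub>R (v - u) = ?l s - ?l t" by (simp add: algebra_simps)
      thus ?thesis using that uv(3) by simp
    qed
    have ij: "i \<noteq> j" using xab0 i j by auto
    have "?l k = ?l ((1 - m0) * i + m0 * j)"
      unfolding k(3)[symmetric] m0(3) i j by (simp add: algebra_simps)
    hence km: "k = i + m0 * (j - i)" using inj by (simp add: algebra_simps)
    \<comment> \<open>In the parameter of the line \<open>u v\<close>, \<open>M\<close> bounds the
      room beyond \<open>x\<close> on \<open>u v\<close> and on either side of \<open>x\<close> on
      \<open>a0 b0\<close>. Half of it is a step that stays inside both.\<close>
    define M where "M = min (1 - k) (\<bar>j - i\<bar> * min m0 (1 - m0))"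
    define d where "d = M / 2"
    have d0: "0 < M" using k m0 ij by (simp add: M_def)
    hence d: "0 < d" "d < 1 - k" "d < \<bar>j - i\<bar> * m0" "d < \<bar>j - i\<bar> * (1 - m0)"
    proof -
      show "0 < d" using d0 by (simp add: d_def)
      have "d < M" using d0 by (simp add: d_def)
      moreover have "M \<le> 1 - k" "M \<le> \<bar>j - i\<bar> * min m0 (1 - m0)" by (simp_all add: M_def)
      moreover have "\<bar>j - i\<bar> * min m0 (1 - m0) \<le> \<bar>j - i\<bar> * m0"
        "\<bar>j - i\<bar> * min m0 (1 - m0) \<le> \<bar>j - i\<bar> * (1 - m0)" by (intro mult_left_mono; simp)+
      ultimately show "d < 1 - k" "d < \<bar>j - i\<bar> * m0" "d < \<bar>j - i\<bar> * (1 - m0)" by linarith+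
    qed
    define t where "t = m0 + d / (j - i)"
    have "t * (j - i) = m0 * (j - i) + d" using ij by (simp add: t_def field_simps)
    hence kt: "k + d = (1 - t) * i + t * j" using km by (simp add: algebra_simps)
    have "\<bar>d / (j - i)\<bar> < m0" "\<bar>d / (j - i)\<bar> < 1 - m0"
      using d ij by (simp_all add: abs_divide pos_divide_less_eq mult.commute)
    hence t: "0 < t" "t < 1" unfolding t_def by linarith+
    have "?l (k + d) \<in> open_segment u v" using d k uv(3) by (intro open_segmentI[of "k + d"]) auto
    moreover have "?l (k + d) \<in> open_segment a0 b0"
    proof (rule open_segmentI[OF t])
      show "?l (k + d) = (1 - t) *\<^sub>R a0 + t *\<^sub>R b0" unfolding kt i j by (simp add: algebra_simps)
      show "a0 \<noteq> b0" using xab0 by auto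
    qed
    ultimately have "?l (k + d) = x" using x by blast
    hence "k + d = k" using inj k(3) by metis
    thus False using d by simp
  qed
  have "\<exists>a b m. a \<in> V \<and> b \<in> V \<and> closed_segment a b \<subseteq> R \<and> 0 < m \<and> m < 1 \<and>
      x = (1 - m) *\<^sub>R a + m *\<^sub>R b \<and> orient u v a > 0"
  proof (cases "orient u v a0 > 0")
    case True thus ?thesis using ab0V ab0R m0 by blast
  next
    case False
    have "m0 * orient u v b0 = - ((1 - m0) * orient u v a0)" using m0(4) crx by linarith
    moreover have "0 < (1 - m0) * (- orient u v a0)" using False nz m0 by (intro mult_pos_pos) auto
    ultimately have "0 < m0 * orient u v b0" by (simp only: mult_minus_right)
    hence "orient u v b0 > 0" using m0 by (simp add: zero_less_mult_iff)
    moreover have "closed_segment b0 a0 \<subseteq> R" using ab0R by (simp add: closed_segment_commute)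
    moreover have "x = (1 - (1 - m0)) *\<^sub>R b0 + (1 - m0) *\<^sub>R a0" using m0 by simp
    ultimately show ?thesis using ab0V m0
      by (intro exI[of _ b0] exI[of _ a0] exI[of _ "1 - m0"]) auto
  qed
  then obtain a b m where ab: "a \<in> V" "b \<in> V" "closed_segment a b \<subseteq> R" and m: "0 < m" "m < 1"
    "x = (1 - m) *\<^sub>R a + m *\<^sub>R b" and da: "orient u v a > 0" by blast
  have s: "(1 - m) * orient u v a + m * orient u v b = 0" using crx unfolding m(3) by (simp add: orient_affine)
  \<comment> \<open>The distances of \<open>a\<close> and \<open>b\<close> from the line
    \<open>u v\<close> are in the ratio \<open>m : 1 - m\<close>; \<open>L\<close> is their common
    factor and cancels from \<open>t\<close>.\<close>
  define L where "L = orient u v a / m"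
  have L: "L > 0" "orient u v a = m * L" using da m by (simp_all add: L_def)
  have db: "orient u v b = - (1 - m) * L"
  proof -
    have "m * orient u v b = m * (- (1 - m) * L)" using s L(2) by (simp add: algebra_simps)
    thus ?thesis using m by simp
  qed
  have db0: "orient u v b < 0" unfolding db using m L by (simp add: mult_neg_pos)
  have "x \<in> closed_segment a b"
    unfolding in_segment(1) by (intro exI[of _ m]) (use m in auto)
  hence "closed_segment x a \<subseteq> closed_segment a b" "closed_segment x b \<subseteq> closed_segment a b"
    by (simp_all add: subset_closed_segment)
  hence xR: "closed_segment x a \<subseteq> R" "closed_segment x b \<subseteq> R" using ab(3) by blast+
  obtain a' A1 B1 C1 where a': "edge u a'" "edge v a'" "0 \<le> A1" "0 \<le> B1" "0 < C1" "A1 + B1 + C1 = 1"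
    "a' = A1 *\<^sub>R u + B1 *\<^sub>R v + C1 *\<^sub>R a"
    using apex_towards[OF edge xuv xI ab(1) xR(1)] da by (metis less_irrefl)
  obtain b' A2 B2 C2 where b': "edge u b'" "edge v b'" "0 \<le> A2" "0 \<le> B2" "0 < C2" "A2 + B2 + C2 = 1"
    "b' = A2 *\<^sub>R u + B2 *\<^sub>R v + C2 *\<^sub>R b"
    using apex_towards[OF edge xuv xI ab(2) xR(2)] db0 by (metis less_irrefl)
  have D1: "orient u v a' = C1 * orient u v a" unfolding a'(7) by (rule orient_bary[OF a'(6)])
  have D2: "orient u v b' = C2 * orient u v b" unfolding b'(7) by (rule orient_bary[OF b'(6)])
  have D1p: "orient u v a' > 0" and D2n: "orient u v b' < 0"
    unfolding D1 D2 using a' b' da db0 by (auto simp: mult_pos_neg)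
  \<comment> \<open>The parameter at which \<open>a' b'\<close> meets the line
    \<open>u v\<close>.\<close>
  define t where "t = orient u v a' / (orient u v a' - orient u v b')"
  have t: "0 < t" "t < 1" using D1p D2n by (auto simp: t_def)
  define N where "N = C1 * m + C2 * (1 - m)"
  have N: "N > 0" using a' b' m by (auto simp: N_def intro!: add_pos_pos)
  have tN: "t = C1 * m / N"
  proof -
    have "t = L * (C1 * m) / (L * N)" by (simp add: t_def D1 D2 L(2) db N_def algebra_simps)
    thus ?thesis using L by simp
  qed
  have tN': "1 - t = C2 * (1 - m) / N" using N by (simp add: tN field_simps N_def)
  define y where "y = (1 - t) *\<^sub>R a' + t *\<^sub>R b'"
  \<comment> \<open>The weights of \<open>a\<close> and \<open>b\<close> in \<open>y\<close> stand
    in the ratio \<open>1 - m : m\<close>, so these two terms recombine to a multiple of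
    \<open>x\<close>, which is on \<open>u v\<close>. Thus \<open>y\<close> gets positive weights on
    \<open>u\<close> and \<open>v\<close> alone.\<close>
  have Q: "(1 - t) * C1 = C1 * C2 / N * (1 - m)" "t * C2 = C1 * C2 / N * m"
    unfolding tN' by (simp, simp add: tN)
  define Q where "Q = C1 * C2 / N"
  have Q0: "Q > 0" using a' b' N by (simp add: Q_def)
  have y_eq: "y = ((1 - t) * A1 + t * A2 + Q * (1 - k)) *\<^sub>R u + ((1 - t) * B1 + t * B2 + Q * k) *\<^sub>R v"
  proof -
    have "y = ((1 - t) * A1 + t * A2) *\<^sub>R u + ((1 - t) * B1 + t * B2) *\<^sub>R v
        + (((1 - t) * C1) *\<^sub>R a + (t * C2) *\<^sub>R b)"
      unfolding y_def a'(7) b'(7) by (simp add: algebra_simps)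
    also have "((1 - t) * C1) *\<^sub>R a + (t * C2) *\<^sub>R b = Q *\<^sub>R ((1 - m) *\<^sub>R a + m *\<^sub>R b)"
      unfolding Q Q_def by (simp add: scaleR_add_right)
    also have "\<dots> = Q *\<^sub>R ((1 - k) *\<^sub>R u + k *\<^sub>R v)" using m(3) k(3) by simp
    finally show ?thesis by (simp add: algebra_simps)
  qed
  have sum1: "((1 - t) * A1 + t * A2 + Q * (1 - k)) + ((1 - t) * B1 + t * B2 + Q * k) = 1"
  proof -
    have "(1 - t) * C1 + t * C2 = Q * (1 - m) + Q * m" unfolding Q Q_def ..
    hence "Q = (1 - t) * C1 + t * C2" by (simp add: right_diff_distrib)
    hence "((1 - t) * A1 + t * A2 + Q * (1 - k)) + ((1 - t) * B1 + t * B2 + Q * k)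
        = (1 - t) * (A1 + B1 + C1) + t * (A2 + B2 + C2)" by (simp add: algebra_simps)
    thus ?thesis using a' b' by simp
  qed
  have pos: "0 < (1 - t) * A1 + t * A2 + Q * (1 - k)" "0 < (1 - t) * B1 + t * B2 + Q * k"
    using t a' b' Q0 k by (auto intro!: add_nonneg_pos)
  have yuv: "y \<in> open_segment u v"
  proof (rule open_segmentI)
    show "y = (1 - ((1 - t) * B1 + t * B2 + Q * k)) *\<^sub>R u + ((1 - t) * B1 + t * B2 + Q * k) *\<^sub>R v"
    proof -
      have e: "(1 - t) * A1 + t * A2 + Q * (1 - k) = 1 - ((1 - t) * B1 + t * B2 + Q * k)"
        using sum1 by linarith
      show ?thesis using y_eq unfolding e .
    qed
  qed (use pos sum1 uv in auto)
  have t1: "open_triangle c u v \<subseteq> I" if "edge u c" "edge v c" "orient u v c \<noteq> 0" for c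
    using that edge edge_sym orient_rotate[of c u v] by (intro open_triangle_subset_I) auto
  have o: "open_segment c y \<subseteq> I" if "edge u c" "edge v c" "orient u v c \<noteq> 0" for c
    using open_segment_subset_open_triangle[OF yuv, of c] t1[OF that] by blast
  have "a' \<noteq> b'" using D1p D2n by auto
  have "open_segment a' b' \<subseteq> I"
  proof
    fix z assume z: "z \<in> open_segment a' b'"
    have yc: "y \<in> closed_segment a' b'"
      unfolding in_segment(1) y_def by (intro exI[of _ t]) (use t in auto)
    have "z \<in> open_segment a' y \<or> z = y \<or> z \<in> open_segment b' y"
      using z Un_closed_segment[OF yc] by (auto simp: open_segment_def closed_segment_commute)
    thus "z \<in> I" using o a' b' D1p D2n yuv uv(4) by (metis less_irrefl subsetD)
  qed
  hence "edge a' b'" using a' b' \<open>a' \<noteq> b'\<close> by (simp add: edge_def)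
  thus thesis using result a' b' D1p D2n by blast
qed

text \<open>If \<open>p\<close> and \<open>w\<close> do not see each other, then the first vertex \<open>p'\<close> met by a ray rotating about
  \<open>p\<close> in the triangle \<open>p y w\<close> is again an apex over \<open>u v\<close>, and the corresponding triangle for \<open>p'\<close>
  contains fewer vertices.\<close>

lemma apex_chain_crossing:
  assumes step: "\<And>p q. edge u p \<Longrightarrow> edge v p \<Longrightarrow> edge u q \<Longrightarrow> edge v q \<Longrightarrow> edge p q \<Longrightarrow> Q p \<Longrightarrow> Q q"
    and uv: "edge u v" and w: "edge u w" "edge v w" "s * orient u v w > 0"
    and p: "edge u p" "edge v p" "s * orient u v p > 0"
    and y: "y \<in> open_segment u w" "y \<in> open_segment v p"
    and Qp: "Q p"
  shows "Q w"
  using p y Qp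
proof (induction "card {z \<in> V. z \<in> convex hull {p, y, w}}" arbitrary: p y rule: less_induct)
  case less
  note p = less.prems(1-3) and y = less.prems(4,5) and Qp = less.prems(6)
  have V: "u \<in> V" "v \<in> V" "u \<noteq> v" "w \<in> V" "p \<in> V" "u \<noteq> w" "v \<noteq> w" "u \<noteq> p" "v \<noteq> p"
    using uv w p by (auto simp: edge_def)
  \<comment> \<open>A clean edge passes through the inside of a side only if the two coincide, but
    \<open>u\<close> is neither \<open>v\<close> nor \<open>p\<close>.\<close>
  have "\<not> side u w"
  proof
    assume "side u w"
    hence "{u, w} = {v, p}" using edge_side[OF p(2) y(2)] y(1) by (auto simp: open_segment_def)
    thus False using V by auto
  qed
  hence uwI: "open_segment u w \<subseteq> I" using w by (simp add: edge_def)
  have "\<not> side v p"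
  proof
    assume "side v p"
    hence "{v, p} = {u, w}" using edge_side[OF w(1) y(1)] y(2) by (auto simp: open_segment_def)
    thus False using V by auto
  qed
  hence vpI: "open_segment v p \<subseteq> I" using p by (simp add: edge_def)
  obtain i where i: "0 < i" "i < 1" "y = (1 - i) *\<^sub>R u + i *\<^sub>R w"
    using y(1) by (auto elim: open_segmentE)
  obtain j where j: "0 < j" "j < 1" "y = (1 - j) *\<^sub>R v + j *\<^sub>R p"
    using y(2) by (auto elim: open_segmentE)
  have nw: "orient u v w \<noteq> 0" and np: "orient u v p \<noteq> 0" using w p by auto
  have cry: "orient u v y = i * orient u v w" unfolding i(3) by (simp add: orient_affine)
  \<comment> \<open>The triangles \<open>y w p\<close> and \<open>u v y\<close> have opposite angles
    at the crossing \<open>y\<close>, so their areas differ by a nonzero factor.\<close>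
  have nc: "orient p y w \<noteq> 0"
  proof -
    have "i *\<^sub>R (w - y) = (1 - i) *\<^sub>R (y - u)" unfolding i(3) by (simp add: algebra_simps)
    moreover have "j *\<^sub>R (p - y) = (1 - j) *\<^sub>R (y - v)" unfolding j(3) by (simp add: algebra_simps)
    ultimately
    have "Im (cnj (i *\<^sub>R (w - y)) * (j *\<^sub>R (p - y))) =
        Im (cnj ((1 - i) *\<^sub>R (y - u)) * ((1 - j) *\<^sub>R (y - v)))" by simp
    hence "(i * j) * orient y w p = ((1 - i) * (1 - j)) * Im (cnj (y - u) * (y - v))"
      by (simp add: orient_def algebra_simps)
    also have "Im (cnj (y - u) * (y - v)) = orient u v y" by (simp add: orient_def algebra_simps)
    finally have "orient y w p \<noteq> 0" using i j nw cry by auto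
    thus ?thesis using orient_rotate[of p y w] by simp
  qed
  have py_sub: "closed_segment p y \<subseteq> insert p (open_segment v p)"
  proof -
    have "open_segment p y \<subseteq> open_segment p v"
      using y(2) by (intro open_segment_subset) (auto simp: open_segment_def closed_segment_commute)
    thus ?thesis using y(2) by (auto simp: open_segment_def closed_segment_commute)
  qed
  have yw_open: "open_segment y w \<subseteq> open_segment u w"
    using y(1) by (intro open_segment_subset) (auto simp: open_segment_def)
  have yw_sub: "closed_segment y w \<subseteq> insert w (open_segment u w)"
    using y(1) yw_open by (auto simp: open_segment_def)
  have ywI: "open_segment y w \<subseteq> I" using yw_open uwI by blast
  have sides: "closed_segment g h \<inter> (closed_segment p y \<union> closed_segment y w) \<subseteq> {p, w} \<or>
      closed_segment g h \<inter> open_triangle p y w = {}" if "side g h" for g h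
  proof -
    have "closed_segment g h \<inter> I = {}" using side_subset_boundary[OF that] B_Int_I by blast
    thus ?thesis using py_sub yw_sub uwI vpI by blast
  qed
  obtain p' y' where p': "p' \<in> V" "y' \<in> open_segment y w \<or> y' = w" "p' \<in> open_segment p y' \<or> p' = y'"
    "open_triangle p y y' \<subseteq> I" "open_segment p p' \<inter> V = {}"
    "open_segment p p' \<subseteq> I \<or> (\<exists>g h. side g h \<and> closed_segment p p' \<subseteq> closed_segment g h)" "p \<noteq> p'"
    by (rule sweep[OF nc sides disjI2[OF ywI], of w]) (use V nc in \<open>auto simp: hull_inc\<close>)
  have Epp': "edge p p'" using edge_from_segment V p' by blast
  show ?case
  proof (cases "p' = y'")
    case True
    hence "p' = w" using p' ywI V_not_I by blast
    thus ?thesis using step[OF p(1,2) w(1,2)] Epp' Qp by blast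
  next
    case False
    hence p'y': "p' \<in> open_segment p y'" using p' by blast
    then obtain n where n: "0 < n" "n < 1" "p' = (1 - n) *\<^sub>R p + n *\<^sub>R y'"
      "\<And>a b. orient a b p' = (1 - n) * orient a b p + n * orient a b y'"
      by (rule orient_open_segment) auto
    have "\<exists>m. 0 < m \<and> m \<le> 1 \<and> y' = (1 - m) *\<^sub>R y + m *\<^sub>R w"
      using p'(2) by (auto elim!: open_segmentE intro: exI[of _ 1] less_imp_le)
    then obtain m where m: "0 < m" "m \<le> 1" "y' = (1 - m) *\<^sub>R y + m *\<^sub>R w" by blast
    have cry': "orient u v y' = ((1 - m) * i + m) * orient u v w"
    proof -
      have "orient u v y' = (1 - m) * orient u v y + m * orient u v w"
        unfolding m(3) by (rule orient_affine) simp
      thus ?thesis by (simp add: cry algebra_simps)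
    qed
    have y'pos: "s * orient u v y' > 0"
    proof -
      have "(1 - m) * i + m > 0" using m i by (intro add_nonneg_pos) auto
      hence "0 < ((1 - m) * i + m) * (s * orient u v w)" using w(3) by (rule mult_pos_pos)
      thus ?thesis unfolding cry' by (simp only: mult.left_commute)
    qed
    have p'pos: "s * orient u v p' > 0"
    proof -
      have "0 < (1 - n) * (s * orient u v p)" "0 < n * (s * orient u v y')"
        using n p(3) y'pos by (auto intro: mult_pos_pos)
      moreover have "s * orient u v p' = (1 - n) * (s * orient u v p) + n * (s * orient u v y')"
        by (simp add: n(4) algebra_simps)
      ultimately show ?thesis by linarith
    qed
    have neq: "u \<noteq> p'" "v \<noteq> p'" using p'pos by auto
    have tp: "open_triangle u v p \<subseteq> I"
      using uv p edge_sym np by (intro open_triangle_subset_I) auto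
    have tw: "open_triangle u v w \<subseteq> I"
      using uv w edge_sym nw by (intro open_triangle_subset_I) auto
    have yy': "open_segment y y' \<subseteq> open_segment y w"
      using p'(2) by (intro open_segment_subset) (auto simp: open_segment_def)
    have y_ne: "y \<noteq> p" "y \<noteq> y'" using y j V p'(2) i by (auto simp: open_segment_def)
    \<comment> \<open>The triangle \<open>u y' p\<close> is cut by \<open>y p\<close> into a part of
      \<open>u v p\<close> and the triangle just swept; both are interior.\<close>
    have "open_segment u p' \<subseteq> I"
    proof -
      have "open_segment u p' \<subseteq> open_triangle u p y'" using p'y' by (rule open_segment_subset_open_triangle)
      also have "\<dots> = open_triangle u y' p" by (rule open_triangle_swap')
      also have "\<dots> \<subseteq> I"
      proof (rule open_triangle_split_subset_I)
        have "y' \<in> closed_segment u w"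
          using p'(2) yw_open by (auto simp: open_segment_def)
        show "y \<in> open_segment u y'"
        proof (rule open_segmentI)
          define M where "M = (1 - m) * i + m"
          have M: "M > i" "M > 0"
          proof -
            have "M - i = m * (1 - i)" by (simp add: M_def algebra_simps)
            moreover have "m * (1 - i) > 0" using m i by simp
            ultimately show "M > i" by linarith
            thus "M > 0" using i by simp
          qed
          have y'M: "y' = (1 - M) *\<^sub>R u + M *\<^sub>R w"
            unfolding m(3) i(3) M_def by (simp add: algebra_simps)
          show "0 < i / M" "i / M < 1" using M i by auto
          have "(1 - i / M) *\<^sub>R u + (i / M) *\<^sub>R y' =
              (1 - i / M + (i / M) * (1 - M)) *\<^sub>R u + (i / M * M) *\<^sub>R w"
            unfolding y'M by (simp only: scaleR_add_right scaleR_scaleR scaleR_add_left add.assoc)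
          moreover have "i / M * M = i" "1 - i / M + (i / M) * (1 - M) = 1 - i"
            using M by (simp_all add: right_diff_distrib)
          ultimately show "y = (1 - i / M) *\<^sub>R u + (i / M) *\<^sub>R y'"
            unfolding i(3) by simp
          show "u \<noteq> y'" using y'pos by auto
        qed
        show "y \<noteq> p" by (rule y_ne)
        have "open_triangle u p y \<subseteq> open_triangle u p v"
          using y(2) by (intro open_triangle_mono) (simp add: open_segment_commute)
        also have "open_triangle u p v = open_triangle u v p" by (rule open_triangle_swap')
        finally have "open_triangle u p y \<subseteq> I" using tp by blast
        thus "open_triangle u y p \<subseteq> I" by (simp only: open_triangle_swap'[of u y p])
        show "open_triangle y' y p \<subseteq> I" using p'(4) by (simp only: open_triangle_rotate[of y'] open_triangle_rotate[of p] open_triangle_swap'[of y y'])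
        show "open_segment y p \<subseteq> I"
          using py_sub vpI by (auto simp: open_segment_def closed_segment_commute)
      qed
      finally show ?thesis .
    qed
    hence Eup': "edge u p'" using V p' neq by (simp add: edge_def)
    have "open_segment v p' \<subseteq> I"
    proof -
      have "open_segment v p' \<subseteq> open_triangle v p y'" using p'y' by (rule open_segment_subset_open_triangle)
      also have "\<dots> \<subseteq> I"
      proof (rule open_triangle_split_subset_I[OF y(2)])
        show "y \<noteq> y'" by (rule y_ne)
        have "open_triangle v y y' \<subseteq> open_triangle v y w" using p'(2) open_triangle_mono by blast
        also have "\<dots> = open_triangle v w y" by (rule open_triangle_swap')
        also have "\<dots> \<subseteq> open_triangle v w u"
          using y(1) by (intro open_triangle_mono) (simp add: open_segment_commute)
        also have "\<dots> = open_triangle u v w" by (rule open_triangle_rotate[symmetric])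
        finally show "open_triangle v y y' \<subseteq> I" using tw by blast
        show "open_triangle p y y' \<subseteq> I" by (rule p'(4))
        show "open_segment y y' \<subseteq> I" using yy' ywI by blast
      qed
      finally show ?thesis .
    qed
    hence Evp': "edge v p'" using V p' neq by (simp add: edge_def)
    have Qp': "Q p'" by (rule step[OF p(1,2) Eup' Evp' Epp' Qp])
    \<comment> \<open>\<open>z\<close> is to be the crossing of \<open>v p'\<close> with
      \<open>u w\<close>. Writing \<open>p\<close> through \<open>y\<close> and \<open>v\<close> in
      the formula for \<open>p'\<close> and moving the term with \<open>v\<close> across turns
      \<open>p' + c *\<^sub>R v\<close> into a combination of \<open>y\<close> and
      \<open>y'\<close>; \<open>W\<close> is the total weight of both sides.\<close>
    define c where "c = (1 - n) * (1 - j) / j"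
    define W where "W = 1 + c"
    have c: "c > 0" using n j by (simp add: c_def)
    have W: "W > 0" "W = (1 - n) / j + n" using c j by (auto simp: W_def c_def field_simps)
    define z where "z = (1 - n / W) *\<^sub>R y + (n / W) *\<^sub>R y'"
    have nW: "0 < n / W" "n / W < 1" using n W j by auto
    have zyy': "z \<in> open_segment y y'"
      using nW y_ne by (intro open_segmentI[of "n / W"]) (auto simp: z_def)
    have zv: "z \<in> open_segment v p'"
    proof (rule open_segmentI)
      show "0 < 1 / W" "1 / W < 1" using c by (auto simp: W_def)
      show "v \<noteq> p'" by (rule neq)
      have pj: "p = (1 / j) *\<^sub>R y - ((1 - j) / j) *\<^sub>R v"
      proof -
        have "p = (1 / j) *\<^sub>R (j *\<^sub>R p)" using j(1) by simp
        also have "j *\<^sub>R p = y - (1 - j) *\<^sub>R v" using j(3) by simp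
        finally show ?thesis by (simp only: scaleR_diff_right scaleR_scaleR times_divide_eq_left mult_1)
      qed
      have "p' + c *\<^sub>R v = ((1 - n) / j) *\<^sub>R y + n *\<^sub>R y'"
        unfolding n(3) c_def by (subst pj) (simp add: scaleR_diff_right)
      also have "(1 - n) / j = W - n" using W by simp
      finally have *: "p' + c *\<^sub>R v = (W - n) *\<^sub>R y + n *\<^sub>R y'" .
      have "W *\<^sub>R z = (W * (1 - n / W)) *\<^sub>R y + (W * (n / W)) *\<^sub>R y'"
        by (simp add: z_def scaleR_add_right)
      also have "W * (1 - n / W) = W - n" using W by (simp add: right_diff_distrib)
      also have "W * (n / W) = n" using W by simp
      finally have Wz: "W *\<^sub>R z = p' + c *\<^sub>R v" using * by simp
      have "W *\<^sub>R ((1 - 1 / W) *\<^sub>R v + (1 / W) *\<^sub>R p') = (W - 1) *\<^sub>R v + p'"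
        using W by (simp add: scaleR_add_right right_diff_distrib)
      also have "\<dots> = W *\<^sub>R z" unfolding Wz by (simp add: W_def)
      finally show "z = (1 - 1 / W) *\<^sub>R v + (1 / W) *\<^sub>R p'" using W by simp
    qed
    have zu: "z \<in> open_segment u w" using zyy' yy' yw_open by blast
    let ?H = "\<lambda>p y. {z \<in> V. z \<in> convex hull {p, y, w}}"
    have "?H p' z \<subset> ?H p y"
    proof
      have y'H: "y' \<in> convex hull {p, y, w}"
        unfolding m(3) using m by (intro in_hull3I[of 0 "1 - m" m]) auto
      have "closed_segment p y' \<subseteq> convex hull {p, y, w}" "closed_segment y y' \<subseteq> convex hull {p, y, w}"
        using y'H by (intro closed_segment_subset; simp add: hull_inc)+
      hence "p' \<in> convex hull {p, y, w}" "z \<in> convex hull {p, y, w}"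
        using p'y' zyy' by (auto simp: open_segment_def)
      hence "convex hull {p', z, w} \<subseteq> convex hull {p, y, w}"
        by (intro hull_minimal) (auto simp: hull_inc)
      thus "?H p' z \<subseteq> ?H p y" by blast
      have z0: "orient u w z = 0" using orient_closed_segment_zero zu by (auto simp: open_segment_def)
      have y'0: "orient u w y' = 0"
        using orient_closed_segment_zero p'(2) yw_open by (auto simp: open_segment_def)
      have "orient u w p \<noteq> 0"
      proof
        assume "orient u w p = 0"
        moreover have "orient u w y = (1 - j) * orient u w v + j * orient u w p"
          unfolding j(3) by (simp add: orient_affine)
        moreover have "orient u w y = 0" unfolding i(3) by (simp add: orient_affine)
        ultimately have "orient u w v = 0" using j by simp
        moreover have "orient u w v = - orient u v w" by (simp add: orient_def algebra_simps)
        ultimately show False using nw by simp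
      qed
      \<comment> \<open>The measure drops because \<open>p\<close> itself is lost: \<open>z\<close>
        and \<open>w\<close> are on the line \<open>u w\<close>, and \<open>p'\<close> has only the
        fraction \<open>1 - n\<close> of the distance of \<open>p\<close> from it.\<close>
      have "p \<notin> convex hull {p', z, w}"
      proof
        assume "p \<in> convex hull {p', z, w}"
        then obtain a b d where abd: "0 \<le> a" "0 \<le> b" "0 \<le> d" "a + b + d = 1"
          "p = a *\<^sub>R p' + b *\<^sub>R z + d *\<^sub>R w" unfolding in_hull3 by blast
        have "orient u w p = a * orient u w p' + b * orient u w z + d * orient u w w"
          by (subst abd(5)) (rule orient_bary3[OF abd(4)])
        hence "orient u w p = a * (1 - n) * orient u w p" using z0 y'0 n(4)[of u w] by simp
        hence "a * (1 - n) = 1" using \<open>orient u w p \<noteq> 0\<close> by simp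
        moreover have "a * (1 - n) \<le> 1 * (1 - n)" using abd n by (intro mult_right_mono) auto
        ultimately show False using n by simp
      qed
      moreover have "p \<in> ?H p y" using V by (simp add: hull_inc)
      ultimately show "?H p' z \<noteq> ?H p y" by blast
    qed
    hence "card (?H p' z) < card (?H p y)" by (intro psubset_card_mono) auto
    thus ?thesis by (rule less.hyps[OF _ Eup' Evp' p'pos zu zv Qp'])
  qed
qed

text \<open>The chain is expressed by a property \<open>Q\<close> that passes between mutually
  visible apexes. The signs of \<open>a\<close> and \<open>b\<close> place \<open>w\<close> relative
  to \<open>u v p\<close>. Neither apex can lie in the triangle of the other or inside its edges, so
  distinct apexes make \<open>u w\<close> cross \<open>v p\<close> or \<open>v w\<close> cross
  \<open>u p\<close>. The second case is the first with \<open>u\<close> and \<open>v\<close>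
  exchanged and \<open>s\<close> negated.\<close>

lemma apex_chain:
  assumes step: "\<And>p q. edge u p \<Longrightarrow> edge v p \<Longrightarrow> edge u q \<Longrightarrow> edge v q \<Longrightarrow> edge p q \<Longrightarrow> Q p \<Longrightarrow> Q q"
    and uv: "edge u v" and w: "edge u w" "edge v w" "s * orient u v w > 0"
    and p: "edge u p" "edge v p" "s * orient u v p > 0"
    and Qp: "Q p"
  shows "Q w"
proof (cases "w = p")
  case False
  have V: "u \<in> V" "v \<in> V" "u \<noteq> v" "w \<in> V" "p \<in> V" using uv w p by (auto simp: edge_def)
  have nw: "orient u v w \<noteq> 0" and np: "orient u v p \<noteq> 0" using w p by auto
  obtain a b c where abc: "a + b + c = 1" "w = a *\<^sub>R u + b *\<^sub>R v + c *\<^sub>R p"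
    using bary_exists[OF np] by blast
  have crw: "orient u v w = c * orient u v p" unfolding abc(2) by (rule orient_bary[OF abc(1)])
  have c: "c > 0"
  proof -
    have "0 < c * (s * orient u v p)" using w(3) unfolding crw by (simp only: mult.left_commute)
    thus ?thesis using p(3) by (rule zero_less_mult_pos2)
  qed
  have tp: "open_triangle u v p \<subseteq> I" using uv p edge_sym np by (intro open_triangle_subset_I) auto
  have tw: "open_triangle u v w \<subseteq> I" using uv w edge_sym nw by (intro open_triangle_subset_I) auto
  have off: "w \<notin> open_segment u p" "w \<notin> open_segment v p" "p \<notin> open_segment u w" "p \<notin> open_segment v w"
    using edge_no_vertex w p V by blast+
  have ne: "u \<noteq> p" "v \<noteq> p" "u \<noteq> w" "v \<noteq> w" using w p by (auto simp: edge_def)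
  have cross: "\<exists>y. y \<in> open_segment u' w \<and> y \<in> open_segment v' p"
    if h: "a' < 0" "0 < b'" "a' + b' + c = 1" "w = a' *\<^sub>R u' + b' *\<^sub>R v' + c *\<^sub>R p" "u' \<noteq> w" "v' \<noteq> p"
    for u' v' a' b'
  proof -
    \<comment> \<open>Moving the negative term across makes \<open>w - a' *\<^sub>R u'\<close> equal
      to a combination of \<open>v'\<close> and \<open>p\<close>; dividing by the total weight
      \<open>1 - a'\<close> gives the crossing point.\<close>
    define y where "y = (1 - 1 / (1 - a')) *\<^sub>R u' + (1 / (1 - a')) *\<^sub>R w"
    have 1: "y \<in> open_segment u' w" using h by (intro open_segmentI[OF _ _ y_def]) auto
    have "(1 - a') *\<^sub>R y = ((1 - a') * (1 - 1 / (1 - a'))) *\<^sub>R u' + w"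
      using h by (simp add: y_def scaleR_add_right)
    also have "(1 - a') * (1 - 1 / (1 - a')) = - a'" using h by (simp add: right_diff_distrib)
    also have "(- a') *\<^sub>R u' + w = b' *\<^sub>R v' + c *\<^sub>R p" by (subst h(4)) simp
    finally have y2: "(1 - a') *\<^sub>R y = b' *\<^sub>R v' + c *\<^sub>R p" .
    have bc: "1 - a' = b' + c" using h by simp
    have "b' + c > 0" using h c by simp
    hence "y = (1 / (b' + c)) *\<^sub>R ((1 - a') *\<^sub>R y)" unfolding bc by simp
    also have "\<dots> = (b' / (b' + c)) *\<^sub>R v' + (c / (b' + c)) *\<^sub>R p"
      unfolding y2 by (simp add: scaleR_add_right)
    also have "b' / (b' + c) = 1 - c / (b' + c)" using \<open>b' + c > 0\<close> by (simp add: field_simps)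
    finally have "y \<in> open_segment v' p"
      using h c by (intro open_segmentI[of "c / (b' + c)"]) auto
    with 1 show ?thesis by blast
  qed
  consider "0 < a" "0 < b" | "a = 0" "0 \<le> b" | "0 < a" "b = 0" | "a < 0" "0 < b" | "a < 0" "b = 0"
    | "b < 0" "0 < a" | "b < 0" "a = 0" | "a < 0" "b < 0" by linarith
  thus ?thesis
  proof cases
    case 1
    hence "w \<in> open_triangle u v p" using abc c by (intro open_triangleI) auto
    thus ?thesis using tp V_not_I V by blast
  next
    case 2
    hence e: "b = 1 - c" using abc by simp
    hence "w = (1 - c) *\<^sub>R v + c *\<^sub>R p" using abc 2 by simp
    moreover have "c < 1" using 2 e abc False by (cases "b = 0") auto
    ultimately have "w \<in> open_segment v p" using c ne by (intro open_segmentI) auto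
    thus ?thesis using off by blast
  next
    case 3
    have e: "a = 1 - c" using 3 abc by simp
    hence "w = (1 - c) *\<^sub>R u + c *\<^sub>R p" using abc 3 by simp
    moreover have "c < 1" using 3 e by simp
    ultimately have "w \<in> open_segment u p" using c ne by (intro open_segmentI) auto
    thus ?thesis using off by blast
  next
    case 4
    then obtain y where y: "y \<in> open_segment u w" "y \<in> open_segment v p"
      using cross[OF 4 abc] ne by blast
    show ?thesis
      by (rule apex_chain_crossing[where u = u and v = v and w = w and s = s and p = p and Q = Q and y = y,
            OF step uv w p y Qp])
  next
    case 5
    have e: "a = 1 - c" using 5 abc by simp
    have "c *\<^sub>R p = w - (1 - c) *\<^sub>R u" using abc 5 by (simp add: e)
    hence "(1 / c) *\<^sub>R (c *\<^sub>R p) = (1 / c) *\<^sub>R (w - (1 - c) *\<^sub>R u)" by simp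
    hence "p = (1 - 1 / c) *\<^sub>R u + (1 / c) *\<^sub>R w"
      using c by (simp add: scaleR_diff_right diff_divide_distrib algebra_simps)
    moreover have "c > 1" using 5 e by simp
    ultimately have "p \<in> open_segment u w" using ne by (intro open_segmentI) auto
    thus ?thesis using off by blast
  next
    case 6
    have abc': "b + a + c = 1" "w = b *\<^sub>R v + a *\<^sub>R u + c *\<^sub>R p" using abc by simp_all
    obtain y where y: "y \<in> open_segment v w" "y \<in> open_segment u p"
      using cross[OF 6 abc'] ne by blast
    have s': "- s * orient v u w > 0" "- s * orient v u p > 0" using w p orient_swap[of v u] by auto
    show ?thesis
      by (rule apex_chain_crossing[where u = v and v = u and s = "- s" and p = p and y = y])
        (use step edge_sym[OF uv] w p y s' Qp in auto)
  next
    case 7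
    have e: "b = 1 - c" using 7 abc by simp
    have "c *\<^sub>R p = w - (1 - c) *\<^sub>R v" using abc 7 by (simp add: e)
    hence "(1 / c) *\<^sub>R (c *\<^sub>R p) = (1 / c) *\<^sub>R (w - (1 - c) *\<^sub>R v)" by simp
    hence "p = (1 - 1 / c) *\<^sub>R v + (1 / c) *\<^sub>R w"
      using c by (simp add: scaleR_diff_right diff_divide_distrib algebra_simps)
    moreover have "c > 1" using 7 e by simp
    ultimately have "p \<in> open_segment v w" using ne by (intro open_segmentI) auto
    thus ?thesis using off by blast
  next
    case 8
    have "p \<in> open_triangle u v w"
    proof (rule open_triangleI)
      show "0 < - a / c" "0 < - b / c" "0 < 1 / c" using 8 c by (auto simp: divide_neg_pos)
      have "1 - a - b = c" using abc by simp
      hence "(- a - b + 1) / c = 1" using c by simp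
      thus "- a / c + - b / c + 1 / c = 1" by (simp add: add_divide_distrib diff_divide_distrib)
      have "c *\<^sub>R p = - a *\<^sub>R u + - b *\<^sub>R v + w" by (subst abc(2)) simp
      hence "(1 / c) *\<^sub>R (c *\<^sub>R p) = (1 / c) *\<^sub>R (- a *\<^sub>R u + - b *\<^sub>R v + w)" by simp
      thus "p = (- a / c) *\<^sub>R u + (- b / c) *\<^sub>R v + (1 / c) *\<^sub>R w"
        using c by (simp add: scaleR_add_right scaleR_diff_right)
    qed
    thus ?thesis using tw V_not_I V by blast
  qed
qed (use Qp in simp)

text \<open>The triangles over the two apexes would put points of the region on both flanks of the
  side, arbitrarily near its midpoint.\<close>

lemma apexes_on_both_sides:
  assumes side: "side u v" and w: "edge u w" "edge v w" "orient u v w > 0" and z: "edge u z" "edge v z" "orient u v z < 0"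
  shows False
proof -
  have uv: "edge u v" "u \<noteq> v" using side side_edge side_ends by auto
  define x where "x = midpoint u v"
  have x: "x \<in> open_segment u v" using uv by (simp add: x_def)
  have near: "\<exists>y \<in> R. dist x y < e \<and> s * orient u v y > 0"
    if q: "edge u q" "edge v q" "s * orient u v q > 0" and e: "e > 0" for q e s
  proof -
    define d where "d = e / (e + dist x q + 1)"
    have n: "e + dist x q + 1 > 0" "dist x q + 1 > 0" using e zero_le_dist[of x q] by linarith+
    have d: "0 < d" "d < 1" using n e by (auto simp: d_def)
    define y where "y = (1 - d) *\<^sub>R x + d *\<^sub>R q"
    have "y \<in> open_triangle u v q"
      using d unfolding y_def x_def midpoint_def
      by (intro open_triangleI[of "(1 - d) / 2" "(1 - d) / 2" d]) (auto simp: algebra_simps)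
    moreover have "orient u v q \<noteq> 0" using q by auto
    hence "open_triangle u v q \<subseteq> I" using uv q edge_sym by (intro open_triangle_subset_I) auto
    ultimately have "y \<in> R" by (auto simp: R_eq)
    moreover have "dist x y < e"
    proof -
      have "x - y = d *\<^sub>R (x - q)" by (simp add: y_def algebra_simps)
      hence "dist x y = d * dist x q" using d by (simp add: dist_norm)
      also have "\<dots> = e * dist x q / (e + dist x q + 1)" by (simp add: d_def)
      also have "\<dots> < e"
      proof -
        have "e * dist x q < e * (e + dist x q + 1)" using e by (intro mult_strict_left_mono) auto
        thus ?thesis using n by (simp add: pos_divide_less_eq)
      qed
      finally show ?thesis .
    qed
    moreover have "orient u v y = d * orient u v q"
    proof -
      have "orient u v x = 0" using x by (auto elim!: open_segmentE simp: orient_affine)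
      thus ?thesis by (simp add: y_def orient_affine)
    qed
    hence "s * orient u v y = d * (s * orient u v q)" by simp
    hence "s * orient u v y > 0" using mult_pos_pos[OF d(1) q(3)] by linarith
    ultimately show ?thesis by blast
  qed
  show False
    by (rule not_R_on_both_sides[OF side x])
      (use near[OF w(1,2), of 1] near[OF z(1,2), of "-1"] w z in auto)
qed

text \<open>The midpoint is a limit of interior points, one of which can be chosen off the line
  \<open>u v\<close>; the half disc containing it is then interior.\<close>

lemma free_side_of_side:
  assumes side: "side u v"
  obtains s :: real where "s = 1 \<or> s = -1" "free_side s u v"
proof -
  note result = that
  have uv: "u \<noteq> v" using side_ends side by blast
  define x where "x = midpoint u v"
  have x: "x \<in> open_segment u v" using uv by (simp add: x_def)
  obtain e where e: "e > 0"
    and half: "\<And>s. \<exists>y \<in> R. dist x y < e \<and> s * orient u v y > 0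
      \<Longrightarrow> ball x e \<inter> {y. s * orient u v y > 0} \<subseteq> I"
    using side_half_balls[OF side x] by blast
  have "x \<in> closure I"
    using x side_subset_boundary[OF side] B_subset_closure_I by (auto simp: open_segment_def)
  moreover have "x \<in> ball x e" using e by simp
  ultimately have "ball x e \<inter> I \<noteq> {}" by (metis IntI disjoint_iff open_Int_closure_eq_empty open_ball)
  then obtain y0 where y0: "y0 \<in> ball x e \<inter> I" by blast
  have "open (ball x e \<inter> I)" using open_I by auto
  then obtain y where y: "y \<in> ball x e \<inter> I" "orient u v y \<noteq> 0"
    using open_meets_off_line y0 uv by metis
  define s :: real where "s = (if orient u v y > 0 then 1 else -1)"
  have s: "s = 1 \<or> s = -1" "s * orient u v y > 0" using y(2) by (auto simp: s_def)
  have H: "ball x e \<inter> {y. s * orient u v y > 0} \<subseteq> I"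
    using half[of s] y s by (auto simp: R_eq)
  have "open_segment x y \<subseteq> I"
  proof
    fix z assume z: "z \<in> open_segment x y"
    then obtain t where t: "0 < t" "orient u v z = (1 - t) * orient u v x + t * orient u v y"
      by (rule orient_open_segment) blast
    have "orient u v x = 0" using x by (auto elim!: open_segmentE simp: orient_affine)
    hence "s * orient u v z = t * (s * orient u v y)" using t by simp
    hence "s * orient u v z > 0" using mult_pos_pos[OF t(1) s(2)] by linarith
    moreover have "z \<in> ball x e"
      using dist_in_open_segment[OF z] y(1) by (auto simp: dist_commute)
    ultimately show "z \<in> I" using H by blast
  qed
  hence "free_side s u v" using x s unfolding free_side_def by blast
  thus thesis using result s by blast
qed

lemma free_side_of_open:
  assumes "open_segment u v \<subseteq> I" "u \<noteq> v" "s \<noteq> 0"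
  shows "free_side s u v"
proof -
  define x where "x = midpoint u v"
  have x: "x \<in> open_segment u v" using assms by (simp add: x_def)
  hence xI: "x \<in> I" using assms by blast
  then obtain e where e: "e > 0" "ball x e \<subseteq> I" using open_I unfolding open_contains_ball by blast
  define c where "c = e / 2 / cmod (v - u)"
  have c: "c > 0" using e assms(2) by (simp add: c_def)
  define z where "z = x + of_real (sgn s * c) * (\<i> * (v - u))"
  have "dist x z = c * cmod (v - u)"
    using c assms(3) by (simp add: z_def dist_norm norm_mult abs_mult abs_sgn_eq)
  also have "\<dots> = e / 2" using assms(2) by (simp add: c_def)
  finally have "z \<in> ball x e" using e by simp
  hence "closed_segment x z \<subseteq> ball x e" using e by (intro closed_segment_subset) auto
  hence 1: "open_segment x z \<subseteq> I" using e by (auto simp: open_segment_def)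
  have "orient u v z = orient u v x + sgn s * c * ((Re (v - u))\<^sup>2 + (Im (v - u))\<^sup>2)"
    by (simp add: orient_def z_def power2_eq_square algebra_simps)
  moreover have "orient u v x = 0" using x by (auto elim!: open_segmentE simp: orient_affine)
  ultimately have "orient u v z = sgn s * c * (cmod (v - u))\<^sup>2" by (simp add: cmod_power2)
  hence "s * orient u v z = \<bar>s\<bar> * c * (cmod (v - u))\<^sup>2" by (simp add: abs_sgn mult_ac)
  hence "s * orient u v z > 0" using c assms by simp
  thus ?thesis unfolding free_side_def using x 1 by blast
qed

lemma sides_at_vertex:
  assumes i: "i < length P" and side: "side (P ! next_idx P i) w"
  shows "w = P ! i \<or> w = P ! next_idx P (next_idx P i)"
proof -
  let ?n = "next_idx P i"
  have n: "?n < length P" by (rule next_idx_less)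
  obtain k where k: "k < length P" "{P ! ?n, w} = {P ! k, P ! next_idx P k}"
    using side by (auto simp: side_def polygon_sides_def)
  consider "P ! ?n = P ! k" "w = P ! next_idx P k" | "P ! ?n = P ! next_idx P k" "w = P ! k"
    using k(2) by (auto simp: doubleton_eq_iff)
  thus ?thesis
  proof cases
    case 1
    hence "?n = k" using k n distinct_P by (simp add: nth_eq_iff_index_eq)
    thus ?thesis using 1 by simp
  next
    case 2
    hence "?n = next_idx P k" using next_idx_less distinct_P by (simp add: nth_eq_iff_index_eq)
    hence "i = k"
      using i k length_ge unfolding next_idx_def
      by (cases "Suc i = length P"; cases "Suc k = length P") auto
    thus ?thesis using 2 by simp
  qed
qed

end

section \<open>Propagating a permutation of the colours\<close>

text \<open>With the permutation fixed beforehand, what has to spread over the polygon is a property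
  of single vertices.\<close>

locale two_colourings = simple_poly +
  fixes c c' \<sigma> :: "_ \<Rightarrow> nat"
  assumes reduced: "reduced_polygon P"
    and c: "proper_colouring V (vis_adj P) 4 c"
    and c': "proper_colouring V (vis_adj P) 4 c'"
    and \<sigma>: "\<sigma> permutes {..<4}"
begin

definition agree :: "complex \<Rightarrow> bool" where
  "agree x \<longleftrightarrow> c' x = \<sigma> (c x)"

lemma colours_less: "x \<in> V \<Longrightarrow> c x < 4" "x \<in> V \<Longrightarrow> c' x < 4"
  using c c' by (auto simp: proper_colouring_def)

lemma edge_colours: "edge x y \<Longrightarrow> c x \<noteq> c y \<and> c' x \<noteq> c' y"
  using edge_vis_adj[of x y] c c' by (auto simp: proper_colouring_def edge_def)

text \<open>The four colours of a clique exhaust the range, so the value of \<open>c'\<close> at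
  \<open>w\<close> is the image under \<open>\<sigma>\<close> of one of them, and three are already
  taken by neighbours.\<close>

lemma clique_agree:
  assumes "edge x y" "edge x z" "edge y z" "edge x w" "edge y w" "edge z w" "agree x" "agree y" "agree z"
  shows "agree w"
proof -
  have V: "x \<in> V" "y \<in> V" "z \<in> V" "w \<in> V" using assms by (auto simp: edge_def)
  have d: "card {c x, c y, c z, c w} = 4" using edge_colours assms(1-6) by simp
  have "{c x, c y, c z, c w} \<subseteq> {..<4}" using colours_less V by auto
  hence full: "{c x, c y, c z, c w} = {..<4}" using d by (intro card_subset_eq) auto
  have "c' w \<in> \<sigma> ` {..<4}" using colours_less V \<sigma> by (simp add: permutes_image)
  hence "c' w \<in> {\<sigma> (c x), \<sigma> (c y), \<sigma> (c z), \<sigma> (c w)}" using full[symmetric] by simp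
  moreover have "c' w \<noteq> c' x" "c' w \<noteq> c' y" "c' w \<noteq> c' z" using edge_colours assms(4-6) by metis+
  ultimately show ?thesis using assms(7-9) by (auto simp: agree_def)
qed

text \<open>Agreement at \<open>u\<close> and \<open>v\<close> alone leaves two colours
  interchangeable, hence the third vertex. It has to be off the line \<open>u v\<close> so that it
  lies on a definite flank.\<close>

definition good :: "complex \<Rightarrow> complex \<Rightarrow> bool" where
  "good u v \<longleftrightarrow> edge u v \<and> agree u \<and> agree v \<and>
    (\<exists>w. edge u w \<and> edge v w \<and> orient u v w \<noteq> 0 \<and> agree w)"

text \<open>On one flank the chain of apexes transports agreement. Apexes on both flanks show that
  \<open>u v\<close> is not a side, so reducedness applies and its four-clique bridges the two
  flanks.\<close>

lemma good_apex:
  assumes g: "good u v" and w: "edge u w" "edge v w" "orient u v w \<noteq> 0"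
  shows "agree w"
proof -
  have uv: "edge u v" "agree u" "agree v" using g by (auto simp: good_def)
  obtain q where q: "edge u q" "edge v q" "orient u v q \<noteq> 0" "agree q" using g by (auto simp: good_def)
  have step: "agree y" if "edge u x" "edge v x" "edge u y" "edge v y" "edge x y" "agree x" for x y
    using clique_agree[of u v x y] that uv by blast
  have same: "agree y" if x: "edge u x" "edge v x" "agree x" and y: "edge u y" "edge v y"
    and s: "s * orient u v x > 0" "s * orient u v y > 0" for x y s
    by (rule apex_chain[where Q = agree and u = u and v = v and w = y and p = x and s = s])
      (use step uv(1) x y s in blast)+
  consider (pos) "orient u v q > 0" "orient u v w > 0" | (neg) "orient u v q < 0" "orient u v w < 0"
    | (pn) "orient u v q > 0" "orient u v w < 0" | (np) "orient u v q < 0" "orient u v w > 0"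
    using q w by linarith
  thus ?thesis
  proof cases
    case pos thus ?thesis using same[of q w 1] q w by simp
  next
    case neg thus ?thesis using same[of q w "-1"] q w by simp
  next
    case pn
    hence "\<not> side u v" using apexes_on_both_sides q w by blast
    then obtain a b where ab: "edge u a" "edge v a" "edge u b" "edge v b" "edge a b" "orient u v a > 0" "orient u v b < 0"
      using crossing_clique[OF reduced, of u v] uv(1) by (auto simp: edge_def)
    have "agree a" using same[of q a 1] q ab pn by simp
    hence "agree b" using step ab by blast
    thus ?thesis using same[of b w "-1"] w ab pn by simp
  next
    case np
    hence "\<not> side u v" using apexes_on_both_sides q w by blast
    then obtain a b where ab: "edge u a" "edge v a" "edge u b" "edge v b" "edge a b" "orient u v a > 0" "orient u v b < 0"
      using crossing_clique[OF reduced, of u v] uv(1) by (auto simp: edge_def)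
    have "agree b" using same[of q b "-1"] q ab np by simp
    hence "agree a" using step ab edge_sym by blast
    thus ?thesis using same[of a w 1] w ab np by simp
  qed
qed

section \<open>Passing from edge to edge around a vertex\<close>

lemma good_sym: "good u v \<Longrightarrow> good v u"
  unfolding good_def using edge_sym orient_swap by (metis neg_equal_0_iff_equal)

text \<open>The old end \<open>v\<close> becomes the agreeing apex over the new edge
  \<open>u w\<close>.\<close>

lemma good_triangle:
  assumes g: "good u v" and w: "edge u w" "edge v w" "orient u v w \<noteq> 0"
  shows "good u w"
proof -
  have "orient u w v \<noteq> 0" using w(3) orient_rotate orient_swap by (metis neg_equal_0_iff_equal)
  moreover have "edge w v" using w edge_sym by blast
  ultimately show ?thesis using g w good_apex[OF assms] unfolding good_def by blast
qed

text \<open>Among the good edges at \<open>v\<close>, take one that is furthest in the direction from \<open>v a\<close> into the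
  interior: if the interior continued beyond it, the triangle there would give a further one.\<close>

lemma good_fan:
  assumes va: "side v a" and g: "good v a" and only: "\<And>w. side v w \<Longrightarrow> w = a \<or> w = b"
  shows "good v b"
proof -
  obtain s :: real where s: "s = 1 \<or> s = -1" "free_side s v a" using free_side_of_side[OF va] .
  have avne: "a \<noteq> v" using va side_ends by blast
  \<comment> \<open>If the free flank of \<open>v a\<close> is the right one, conjugation reverses
    orientation, so a counterclockwise sweep treats both cases.\<close>
  define f :: "complex \<Rightarrow> complex" where "f = (if s = 1 then id else cnj)"
  have f: "f (f z) = z" "f (x *\<^sub>R z + y *\<^sub>R z') = x *\<^sub>R f z + y *\<^sub>R f z'" "f 1 = 1"
    "Im (cnj (f z) * f z') = s * Im (cnj z * z')" for x y z z'
    using s by (auto simp: f_def algebra_simps)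
  \<comment> \<open>Division by \<open>a - v\<close> puts the direction of \<open>a\<close> on the
    positive real axis, where \<open>Arg2pi\<close> starts.\<close>
  define h where "h w = (w - v) / (a - v)" for w
  define \<theta> where "\<theta> w = Arg2pi (f (h w))" for w
  define X where "X = {w \<in> V. good v w}"
  have X: "finite X" "a \<in> X" using g by (auto simp: X_def good_def edge_def)
  define M where "M = Max (\<theta> ` X)"
  have M: "\<theta> w \<le> M" if "w \<in> X" for w using X that by (simp add: M_def)
  have "M \<in> \<theta> ` X" using X unfolding M_def by (intro Max_in) auto
  then obtain w where w: "w \<in> X" "\<theta> w = M" by blast
  have gw: "good v w" and Ew: "edge v w" using w by (auto simp: X_def good_def)
  have wne: "w \<noteq> v" using Ew by (auto simp: edge_def)
  have "\<not> free_side s v w"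
  proof
    assume "free_side s v w"
    then obtain w' where w': "edge v w'" "edge w w'" "s * orient v w w' > 0"
      using apex_on_free_side[OF Ew] by blast
    have nc: "orient v w w' \<noteq> 0" using w' by auto
    have "good v w'" by (rule good_triangle[OF gw w'(1,2) nc])
    hence le: "\<theta> w' \<le> \<theta> w" using M w w' by (simp add: X_def edge_def)
    have "cnj (h w) * h w' = (cnj (w - v) * (w' - v)) / of_real ((cmod (a - v))\<^sup>2)"
      unfolding h_def complex_norm_square by (simp add: mult.commute)
    hence "Im (cnj (h w) * h w') = orient v w w' / (cmod (a - v))\<^sup>2" by (simp add: orient_def)
    moreover have "0 < s * orient v w w' / (cmod (a - v))\<^sup>2" using w'(3) avne by simp
    ultimately have "Im (cnj (f (h w)) * f (h w')) > 0" unfolding f(4) by simp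
    \<comment> \<open>The turn from \<open>w\<close> to \<open>w'\<close> is counterclockwise after
      \<open>f\<close> and less than a half turn, yet the angle does not grow; so it reaches or
      passes the direction of \<open>a\<close>.\<close>
    then obtain l m where lm: "0 \<le> l" "0 < m" "1 = l *\<^sub>R f (h w) + m *\<^sub>R f (h w')"
      using Arg2pi_wraps_cone le unfolding \<theta>_def by blast
    have "1 = f (l *\<^sub>R f (h w) + m *\<^sub>R f (h w'))" unfolding lm(3)[symmetric] by (simp only: f(3))
    hence "1 = l *\<^sub>R h w + m *\<^sub>R h w'" by (simp only: f(1,2))
    hence "a - v = (l *\<^sub>R h w + m *\<^sub>R h w') * (a - v)" by simp
    also have "\<dots> = l *\<^sub>R (w - v) + m *\<^sub>R (w' - v)"
      using avne by (simp add: h_def distrib_right)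
    finally have cone: "a - v = l *\<^sub>R (w - v) + m *\<^sub>R (w' - v)" .
    have tI: "open_triangle v w w' \<subseteq> I" using Ew w' edge_sym nc by (intro open_triangle_subset_I) auto
    show False
    proof (cases "l = 0")
      case False
      \<comment> \<open>Close to \<open>v\<close> the side \<open>v a\<close> would run inside the
        triangle \<open>v w w'\<close>; this \<open>e\<close> leaves positive weight on
        \<open>v\<close>.\<close>
      define e where "e = 1 / (l + m + 1)"
      have e: "0 < e" "e \<le> 1" "e * (l + m) < 1" using lm by (auto simp: e_def divide_le_eq)
      define y where "y = v + e *\<^sub>R (a - v)"
      have "y \<in> open_triangle v w w'"
      proof (rule open_triangleI)
        show "0 < 1 - e * (l + m)" "0 < e * l" "0 < e * m" using e lm False by auto
        show "1 - e * (l + m) + e * l + e * m = 1" by (simp add: algebra_simps)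
        show "y = (1 - e * (l + m)) *\<^sub>R v + (e * l) *\<^sub>R w + (e * m) *\<^sub>R w'"
          unfolding y_def cone by (simp add: algebra_simps)
      qed
      moreover have "y = (1 - e) *\<^sub>R v + e *\<^sub>R a" by (simp add: y_def algebra_simps)
      hence "y \<in> closed_segment v a" unfolding in_segment(1) using e by (intro exI[of _ e]) auto
      ultimately show False using tI side_subset_boundary[OF va] B_Int_I by blast
    next
      case True
      \<comment> \<open>Now \<open>w'\<close> lies in the direction of \<open>a\<close>. No vertex
        is inside either edge, so \<open>w' = a\<close>, and \<open>w\<close> and the apex
        \<open>z\<close> would lie on opposite flanks of the side \<open>v a\<close>.\<close>
      hence am: "a - v = m *\<^sub>R (w' - v)" using cone by simp
      have w'ne: "v \<noteq> w'" using w' by (auto simp: edge_def)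
      have V: "a \<in> V" "w' \<in> V" using va side_ends w' by (auto simp: edge_def)
      have "m = 1"
      proof (rule ccontr)
        assume "m \<noteq> 1"
        then consider "m < 1" | "m > 1" by linarith
        thus False
        proof cases
          case 1
          have "a = (1 - m) *\<^sub>R v + m *\<^sub>R w'" using am by (simp add: algebra_simps)
          hence "a \<in> open_segment v w'" using 1 lm w'ne by (intro open_segmentI) auto
          thus False using edge_no_vertex[OF w'(1) V(1)] by blast
        next
          case 2
          have "(1 / m) *\<^sub>R (a - v) = w' - v" using am lm by simp
          hence "w' = (1 - 1 / m) *\<^sub>R v + (1 / m) *\<^sub>R a" by (simp add: algebra_simps)
          hence "w' \<in> open_segment v a" using 2 avne by (intro open_segmentI[of "1 / m"]) auto
          thus False using edge_no_vertex[OF side_edge[OF va] V(2)] by blast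
        qed
      qed
      hence w'a: "w' = a" using am by simp
      obtain z where z: "edge v z" "edge a z" "s * orient v a z > 0"
        using apex_on_free_side[OF side_edge[OF va] s(2)] by blast
      have "s * orient v a w < 0"
      proof -
        have "orient v a w = - orient v w a" by (simp add: orient_def algebra_simps)
        thus ?thesis using w'(3) w'a by simp
      qed
      thus False
        using s(1) apexes_on_both_sides[OF va z(1,2), of w] apexes_on_both_sides[OF va Ew _ _ z(1,2)]
          z(3) Ew edge_sym[OF w'(2)] w'a by auto
    qed
  qed
  moreover have "s \<noteq> 0" using s by auto
  \<comment> \<open>An edge through the open interior has both flanks free, so the extreme edge is a
    side; it differs from \<open>v a\<close>, whose flank \<open>s\<close> is free.\<close>
  ultimately have "side v w" using free_side_of_open[of v w s] Ew by (auto simp: edge_def)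
  moreover have "w \<noteq> a" using \<open>\<not> free_side s v w\<close> s(2) by blast
  ultimately have "w = b" using only by blast
  thus ?thesis using gw by simp
qed

lemma all_agree:
  assumes start: "good (P ! 0) (P ! next_idx P 0)" and x: "x \<in> V"
  shows "agree x"
proof -
  have "good (P ! i) (P ! next_idx P i)" if "i < length P" for i
    using that
  proof (induction i)
    case 0
    show ?case by (rule start)
  next
    case (Suc i)
    hence i: "i < length P" and g: "good (P ! i) (P ! next_idx P i)" by auto
    have n: "next_idx P i = Suc i" using Suc.prems by (rule next_idx_Suc)
    show ?case
      unfolding n[symmetric]
      by (rule good_fan[OF side_sym[OF side_nth[OF i]] good_sym[OF g]]) (rule sides_at_vertex[OF i])
  qed
  moreover obtain i where "i < length P" "x = P ! i" using x by (auto simp: in_set_conv_nth)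
  ultimately show ?thesis by (auto simp: good_def)
qed

end

theorem theorem2p4:
  fixes P :: "complex list"
  assumes "simple_polygon P"
    and "reduced_polygon P"
    and "colourable (set P) (vis_adj P) 4"
  shows "uniquely_colourable (set P) (vis_adj P) 4"
proof -
  interpret simple_poly P using assms(1) by unfold_locales
  obtain c where c: "proper_colouring V (vis_adj P) 4 c" using assms(3) by (auto simp: colourable_def)
  let ?u = "P ! 0" and ?v = "P ! next_idx P 0"
  have "0 < length P" using length_ge by linarith
  hence side: "side ?u ?v" by (rule side_nth)
  obtain s where s: "free_side s ?u ?v" using free_side_of_side[OF side] by blast
  obtain w where w: "edge ?u w" "edge ?v w" "s * orient ?u ?v w > 0"
    using apex_on_free_side[OF side_edge[OF side] s] by blast
  have "\<exists>p. p permutes {..<4} \<and> (\<forall>v\<in>V. c' v = p (c v))"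
    if c': "proper_colouring V (vis_adj P) 4 c'" for c'
  proof -
    define T where "T = {?u, ?v, w}"
    have T: "T \<subseteq> V" using w by (auto simp: edge_def T_def)
    have inj: "inj_on d T" if d: "proper_colouring V (vis_adj P) 4 d" for d
    proof -
      have "d x \<noteq> d y" if "edge x y" for x y
        using that edge_vis_adj[OF that] d by (auto simp: proper_colouring_def edge_def)
      hence "d ?u \<noteq> d ?v" "d ?u \<noteq> d w" "d ?v \<noteq> d w" using w side_edge[OF side] by blast+
      thus ?thesis unfolding inj_on_def T_def by (metis insertE singletonD)
    qed
    \<comment> \<open>On the starting triangle both colourings are injective, so \<open>f\<close>
      translates one into the other on three colours before it is extended.\<close>
    define f where "f = c' \<circ> inv_into T c"
    have fc: "f (c x) = c' x" if "x \<in> T" for x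
      using inj[OF c] that by (simp add: f_def)
    have "inj_on (f \<circ> c) T" using inj[OF c'] fc by (simp add: inj_on_def)
    hence "inj_on f (c ` T)" by (rule inj_on_imageI)
    moreover have "c ` T \<subseteq> {..<4}" "c' ` T \<subseteq> {..<4}"
      using T c c' by (auto simp: proper_colouring_def)
    moreover have "f ` c ` T = c' ` T" using fc by (simp add: image_image)
    ultimately obtain \<tau> where \<tau>: "\<tau> permutes {..<4}" "\<And>k. k \<in> c ` T \<Longrightarrow> \<tau> k = f k"
      using permutes_extending[of "{..<4}" "c ` T" f] finite_lessThan by metis
    interpret two_colourings P c c' \<tau>
      using assms(2) c c' \<tau>(1) by unfold_locales
    have ag: "agree x" if "x \<in> T" for x using that \<tau>(2) fc by (simp add: agree_def)
    have "agree ?u" "agree ?v" "agree w" by (rule ag, simp add: T_def)+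
    moreover have "orient ?u ?v w \<noteq> 0" using w by auto
    ultimately have "good ?u ?v" using w side_edge[OF side] unfolding good_def by blast
    hence "\<forall>x\<in>V. c' x = \<tau> (c x)" using all_agree by (auto simp: agree_def)
    thus ?thesis using \<tau> by blast
  qed
  thus ?thesis using c unfolding uniquely_colourable_def by blast
qed

end
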